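(* Let $g:\mathbb{R}^n\to\mathbb{R}$ and $q=(q_1,\dots,q_m):\mathbb{R}^n\to\mathbb{R}^m$ be twice continuously differentiable, let $\Gamma=\{x: q_i(x)\le 0,\ i=1,\dots,m\}$, and consider the problem of minimizing $g(x)$ subject to $x\in\Gamma$. Let $\bar x\in\Gamma$ be a stationary point of this problem and let $\kappa,\gamma>0$ be real numbers. Suppose that MSCQ is fulfilled at $\bar x$ and $\gamma>\operatorname{subreg}Q_q(\bar x|0)$. Then the following assertions are equivalent: (i) The point $\bar x$ is a tilt-stable local minimizer of the problem with modulus $\kappa$. (ii) The relaxed uniform second-order sufficient condition (RUSOSC) is satisfied at $\bar x$ with modulus $\ell:=\kappa^{-1}$. (iii) There exists $\eta>0$ such that $$\langle\nabla^2_{xx}L(x,\lambda)w,w\rangle\ge\frac1\kappa\|w\|^2$$ whenever $(x,v)\in\operatorname{gph}\Psi\cap\mathbb{B}_\eta(\bar x,0)$ and $\lambda\in\Lambda(x,v-\nabla g(x);w)\cap\gamma\|v-\nabla g(x)\|\,\mathbb{B}_{\mathbb{R}^m}$ with $w\in\mathbb{R}^n$ satisfying $$\langle\nabla q_i(x),w\rangle=0\ \text{ for } i\in I^+(\lambda)\quad\text{and}\quad\langle\nabla q_i(x),w\rangle\ge0\ \text{ for } i\in I(x)\setminus I^+(\lambda).$$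
   Context: Norms are Euclidean; $\mathbb{B}_r(a)$ is the closed ball of radius $r$ about $a$; $\mathbb{B}_{\mathbb{R}^m}$ is the closed unit ball of $\mathbb{R}^m$; $d(\cdot\,;\cdot)$ is the distance from a point to a set; $\mathbb{R}^m_-$ and $\mathbb{R}^m_+$ are the nonpositive and nonnegative orthants. Normal cones: $T_\Gamma(x)=\{v:\exists\,t_k\downarrow0,\ v_k\to v,\ x+t_kv_k\in\Gamma\}$ is the tangent cone, $\widehat N_\Gamma(x)=\{v:\langle v,w\rangle\le0\ \forall w\in T_\Gamma(x)\}$, and $N_\Gamma(x)=\{v:\exists\,x_k\to x,\ x_k\in\Gamma,\ v_k\in\widehat N_\Gamma(x_k),\ v_k\to v\}$ is the limiting normal cone for $x\in\Gamma$ (empty if $x\notin\Gamma$). Put $\Psi(x)=\nabla g(x)+N_\Gamma(x)$ and $\operatorname{gph}\Psi=\{(x,v):v\in\Psi(x)\}$. Active indices: $I(x)=\{i:q_i(x)=0\}$ for $x\in\Gamma$; $I^+(\lambda)=\{i:\lambda_i>0\}$ for $\lambda\in\mathbb{R}^m_+$. Lagrangian: $L(x,\lambda)=g(x)+\lambda^Tq(x)$. A point $x\in\Gamma$ is stationary if there is $\lambda\in\mathbb{R}^m_+$ with $\nabla_xL(x,\lambda)=0$ and $\lambda_iq_i(x)=0$ for all $i$. Multipliers: $\Lambda(x,x^* )=\{\lambda\in\mathbb{R}^m_+:\nabla q(x)^T\lambda=x^*,\ \lambda_i=0\text{ for }i\notin I(x)\}$. For $w\in\mathbb{R}^n$, $\Lambda(x,x^*;w)$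 is the set of optimal solutions of the linear program: minimize $-w^T\nabla^2(\lambda^Tq)(x)w$ over $\lambda\in\Lambda(x,x^* )$. MSCQ (metric subregularity constraint qualification) holds at $\bar x\in\Gamma$ if there are a neighborhood $U$ of $\bar x$ and $c>0$ such that $d(x;\Gamma)\le c\,d(q(x);\mathbb{R}^m_-)$ for all $x\in U$. With $Q_q(x)=q(x)-\mathbb{R}^m_-$, the modulus $\operatorname{subreg}Q_q(\bar x|0)$ is the infimum of all such $c$ (over all neighborhoods $U$). RUSOSC holds at $\bar x$ with modulus $\ell>0$ if there is $\eta>0$ such that $\langle\nabla^2_{xx}L(x,\lambda)w,w\rangle\ge\ell\|w\|^2$ whenever $(x,v)\in\operatorname{gph}\Psi\cap\mathbb{B}_\eta(\bar x,0)$ and $\lambda\in\Lambda(x,v-\nabla g(x);w)$ with $w\in\mathbb{R}^n$ satisfying $\langle\nabla q_i(x),w\rangle=0$ for $i\in I^+(\lambda)$ and $\langle\nabla q_i(x),w\rangle\ge0$ for $i\in I(x)\setminus I^+(\lambda)$. Tilt stability: $\bar x\in\Gamma$ is a tilt-stable local minimizer of the problem with modulus $\kappa>0$ if there is $\gamma_0>0$ such that the mapping $v\mapsto\operatorname{argmin}\{g(x)-\langle v,x\rangle: x\in\Gamma\cap\mathbb{B}_{\gamma_0}(\bar x)\}$ is single-valued and Lipschitz continuous with constant $\kappa$ on some neighborhood of $0\in\mathbb{R}^n$, with value $\bar x$ at $v=0$. *)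

theory Defs
  imports "HOL-Analysis.Analysis"
begin

section \<open>Gradients and Hessians\<close>

definition grad :: "(real ^ 'n \<Rightarrow> real) \<Rightarrow> real ^ 'n \<Rightarrow> real ^ 'n" where
  "grad f x = (THE D. GDERIV f x :> D)"

definition hess :: "(real ^ 'n \<Rightarrow> real) \<Rightarrow> real ^ 'n \<Rightarrow> real ^ 'n ^ 'n" where
  "hess f x = jacobian (grad f) (at x)"

definition C2 :: "(real ^ 'n \<Rightarrow> real) \<Rightarrow> bool" where
  "C2 f \<longleftrightarrow> f differentiable_on UNIV \<and> grad f differentiable_on UNIV \<and> continuous_on UNIV (hess f)"

lemma grad_eqI:
  assumes "GDERIV f x :> D"
  shows "grad f x = D"
  unfolding grad_def
proof (rule the_equality)
  show "GDERIV f x :> D" by (rule assms)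
  fix E assume "GDERIV f x :> E"
  then have "(\<lambda>h. inner h E) = (\<lambda>h. inner h D)"
    using assms unfolding gderiv_def by (rule has_derivative_unique)
  then have "\<forall>h. inner h E = inner h D"
    by (simp add: fun_eq_iff)
  then show "E = D"
    by (simp only: vector_eq_ldot)
qed

lemma GDERIV_grad:
  assumes "f differentiable at x"
  shows "GDERIV f x :> grad f x"
proof -
  obtain f' where f': "(f has_derivative f') (at x)"
    using assms unfolding differentiable_def by blast
  have "inner h (adjoint f' 1) = f' h" for h
    using adjoint_works[OF has_derivative_linear[OF f'], of h 1] by simp
  then have D: "GDERIV f x :> adjoint f' 1"
    using f' unfolding gderiv_def by simp
  show ?thesis
    using D unfolding grad_eqI[OF D] .
qed

section \<open>Tangent and normal cones\<close>

definition tangent_cone :: "('a::real_inner) set \<Rightarrow> 'a \<Rightarrow> 'a set" where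
  "tangent_cone S x = {v. \<exists>(t :: nat \<Rightarrow> real) (u :: nat \<Rightarrow> 'a).
     (\<forall>k. 0 < t k) \<and> t \<longlonglongrightarrow> 0 \<and> u \<longlonglongrightarrow> v \<and> (\<forall>k. x + t k *\<^sub>R u k \<in> S)}"

definition regular_normal_cone :: "('a::real_inner) set \<Rightarrow> 'a \<Rightarrow> 'a set" where
  "regular_normal_cone S x = {v. \<forall>w\<in>tangent_cone S x. v \<bullet> w \<le> 0}"

definition limiting_normal_cone :: "('a::real_inner) set \<Rightarrow> 'a \<Rightarrow> 'a set" where
  "limiting_normal_cone S x = (if x \<in> S
     then {v. \<exists>(y :: nat \<Rightarrow> 'a) (u :: nat \<Rightarrow> 'a). y \<longlonglongrightarrow> x \<and> (\<forall>k. y k \<in> S) \<and>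
            (\<forall>k. u k \<in> regular_normal_cone S (y k)) \<and> u \<longlonglongrightarrow> v}
     else {})"

section \<open>The nonlinear program\<close>

definition nonneg_orthant :: "(real ^ 'm) set" where
  "nonneg_orthant = {y. \<forall>i. 0 \<le> y $ i}"

definition nonpos_orthant :: "(real ^ 'm) set" where
  "nonpos_orthant = {y. \<forall>i. y $ i \<le> 0}"

definition feasible_set :: "(real ^ 'n \<Rightarrow> real ^ 'm) \<Rightarrow> (real ^ 'n) set" where
  "feasible_set q = {x. \<forall>i. q x $ i \<le> 0}"

definition Psi :: "(real ^ 'n \<Rightarrow> real) \<Rightarrow> (real ^ 'n \<Rightarrow> real ^ 'm) \<Rightarrow> real ^ 'n \<Rightarrow> (real ^ 'n) set" where
  "Psi g q x = {grad g x + u | u. u \<in> limiting_normal_cone (feasible_set q) x}"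

definition gph :: "('a \<Rightarrow> 'b set) \<Rightarrow> ('a \<times> 'b) set" where
  "gph F = {(x, v). v \<in> F x}"

definition active :: "(real ^ 'n \<Rightarrow> real ^ 'm) \<Rightarrow> real ^ 'n \<Rightarrow> 'm set" where
  "active q x = {i. q x $ i = 0}"

definition pos_indices :: "real ^ 'm \<Rightarrow> 'm set" where
  "pos_indices l = {i. 0 < l $ i}"

definition Lagr :: "(real ^ 'n \<Rightarrow> real) \<Rightarrow> (real ^ 'n \<Rightarrow> real ^ 'm) \<Rightarrow> real ^ 'n \<Rightarrow> real ^ 'm \<Rightarrow> real" where
  "Lagr g q x l = g x + l \<bullet> q x"

definition stationary_point :: "(real ^ 'n \<Rightarrow> real) \<Rightarrow> (real ^ 'n \<Rightarrow> real ^ 'm) \<Rightarrow> real ^ 'n \<Rightarrow> bool" where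
  "stationary_point g q x \<longleftrightarrow> x \<in> feasible_set q \<and>
     (\<exists>l\<in>nonneg_orthant. grad (\<lambda>y. Lagr g q y l) x = 0 \<and> (\<forall>i. l $ i * q x $ i = 0))"

definition multipliers :: "(real ^ 'n \<Rightarrow> real ^ 'm) \<Rightarrow> real ^ 'n \<Rightarrow> real ^ 'n \<Rightarrow> (real ^ 'm) set" where
  "multipliers q x xs = {l \<in> nonneg_orthant.
     transpose (jacobian q (at x)) *v l = xs \<and> (\<forall>i. i \<notin> active q x \<longrightarrow> l $ i = 0)}"

definition dir_multipliers ::
  "(real ^ 'n \<Rightarrow> real ^ 'm) \<Rightarrow> real ^ 'n \<Rightarrow> real ^ 'n \<Rightarrow> real ^ 'n \<Rightarrow> (real ^ 'm) set" where
  "dir_multipliers q x xs w = {l. is_arg_min (\<lambda>l. - (w \<bullet> (hess (\<lambda>y. l \<bullet> q y) x *v w)))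
     (\<lambda>l. l \<in> multipliers q x xs) l}"

section \<open>Metric subregularity\<close>

definition mscq_const :: "(real ^ 'n \<Rightarrow> real ^ 'm) \<Rightarrow> real ^ 'n \<Rightarrow> real \<Rightarrow> bool" where
  "mscq_const q xb c \<longleftrightarrow> 0 < c \<and> (\<exists>U. open U \<and> xb \<in> U \<and>
     (\<forall>x\<in>U. infdist x (feasible_set q) \<le> c * infdist (q x) nonpos_orthant))"

definition MSCQ :: "(real ^ 'n \<Rightarrow> real ^ 'm) \<Rightarrow> real ^ 'n \<Rightarrow> bool" where
  "MSCQ q xb \<longleftrightarrow> xb \<in> feasible_set q \<and> (\<exists>c. mscq_const q xb c)"

text \<open>The modulus of metric subregularity of \<open>x \<mapsto> q x - nonpos_orthant\<close> at \<open>xb\<close> for \<open>0\<close>.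
  It is extended-real-valued, so that it is \<open>\<infinity>\<close> when no constant exists.\<close>

definition subreg :: "(real ^ 'n \<Rightarrow> real ^ 'm) \<Rightarrow> real ^ 'n \<Rightarrow> ereal" where
  "subreg q xb = Inf {ereal c | c. mscq_const q xb c}"

section \<open>RUSOSC and tilt stability\<close>

definition RUSOSC ::
  "(real ^ 'n \<Rightarrow> real) \<Rightarrow> (real ^ 'n \<Rightarrow> real ^ 'm) \<Rightarrow> real ^ 'n \<Rightarrow> real \<Rightarrow> bool" where
  "RUSOSC g q xb l \<longleftrightarrow> 0 < l \<and> (\<exists>\<eta>>0. \<forall>x v lam w.
     (x, v) \<in> gph (Psi g q) \<inter> cball (xb, 0) \<eta> \<longrightarrow>
     lam \<in> dir_multipliers q x (v - grad g x) w \<longrightarrow>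
     (\<forall>i\<in>pos_indices lam. grad (\<lambda>y. q y $ i) x \<bullet> w = 0) \<longrightarrow>
     (\<forall>i\<in>active q x - pos_indices lam. 0 \<le> grad (\<lambda>y. q y $ i) x \<bullet> w) \<longrightarrow>
     l * (norm w)\<^sup>2 \<le> (hess (\<lambda>y. Lagr g q y lam) x *v w) \<bullet> w)"

definition tilt_argmin ::
  "(real ^ 'n \<Rightarrow> real) \<Rightarrow> (real ^ 'n) set \<Rightarrow> real ^ 'n \<Rightarrow> real \<Rightarrow> real ^ 'n \<Rightarrow> (real ^ 'n) set" where
  "tilt_argmin g S xb \<gamma> v = {x. is_arg_min (\<lambda>x. g x - v \<bullet> x) (\<lambda>x. x \<in> S \<inter> cball xb \<gamma>) x}"

definition tilt_stable_minimizer ::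
  "(real ^ 'n \<Rightarrow> real) \<Rightarrow> (real ^ 'n \<Rightarrow> real ^ 'm) \<Rightarrow> real ^ 'n \<Rightarrow> real \<Rightarrow> bool" where
  "tilt_stable_minimizer g q xb \<kappa> \<longleftrightarrow> xb \<in> feasible_set q \<and> 0 < \<kappa> \<and>
     (\<exists>\<gamma>>0. \<exists>V s. open V \<and> 0 \<in> V \<and>
        (\<forall>v\<in>V. tilt_argmin g (feasible_set q) xb \<gamma> v = {s v}) \<and>
        \<kappa>-lipschitz_on V s \<and> s 0 = xb)"

end

theory Submission
  imports Defs
begin

text \<open>The three assertions are linked in a cycle, (i) to (ii) to (iii) to (i), where (ii) to (iii)
  only discards some triples. Throughout, \<open>\<Gamma>\<close> is the feasible set and \<open>c\<close> is an admissible constant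
  of metric subregularity with \<open>c < \<gamma>\<close>.

  The basic tool is the error bound \<open>d(x; \<Gamma>) \<le> c d(q x; nonpos_orthant)\<close>. It lets one correct a curve
  \<open>x + t u + (t\<^sup>2 / 2) z\<close> to a feasible one at a cost controlled by the violated linearized
  constraints (\<open>feasible_arc\<close>). Consequently an inequality that holds on feasible curves holds for all
  \<open>z\<close> with a penalty on the violation, and separating a point from the compact convex image of the
  multipliers of bounded norm turns such an inequality into a multiplier
  (\<open>bounded_multiplier_alternative\<close>). This yields that every limiting normal \<open>x\<^sup>*\<close> has a multiplier of
  norm at most \<open>c \<parallel>x\<^sup>*\<parallel>\<close>, that the second-order necessary condition holds, and that the normals of \<open>\<Gamma>\<close>
  are uniformly prox-regular, so that \<open>Psi\<close> becomes strongly monotone after adding a large multiple of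
  the identity.

  From (i) to (ii): the conjugate of \<open>g\<close> restricted to \<open>\<Gamma>\<close> near \<open>xb\<close> has the
  \<open>\<kappa>\<close>-Lipschitz gradient \<open>s\<close>, and the descent inequality for this conjugate dualizes to the growth
  \<open>g y \<ge> g x + v \<bullet> (y - x) + \<parallel>y - x\<parallel>\<^sup>2 / (2 \<kappa>)\<close> at \<open>x = s v\<close> (\<open>argmin_quadratic_growth\<close>). By
  hypomonotonicity every point of the graph of \<open>Psi\<close> near \<open>(xb, 0)\<close> has this form \<open>(s v, v)\<close>, and the
  necessary condition for the growth inequality is RUSOSC.

  From (iii) to (i): for large \<open>r\<close> let \<open>P z\<close> minimize \<open>g y + r \<parallel>y\<parallel>\<^sup>2 / 2 - z \<bullet> y\<close> over \<open>\<Gamma>\<close> near \<open>xb\<close>. Limits of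
  difference quotients of \<open>P\<close> yield tangents to the graph of the normal cone, and along each such tangent
  \<open>normal_cone_graphical_derivative\<close> provides a multiplier of norm at most \<open>\<gamma> \<parallel>x\<^sup>*\<parallel>\<close> that solves the linear
  program in (iii) and computes the second-order form. Hence (iii) bounds the slope of \<open>P\<close> at
  every point by \<open>L = 1 / (r + 1 / \<kappa>)\<close>, and \<open>P\<close> is \<open>L\<close>-Lipschitz. Since
  \<open>r L < 1\<close>, the equation \<open>x = P (v + r x)\<close> has a unique solution \<open>s v\<close>, which is \<open>\<kappa>\<close>-Lipschitz in \<open>v\<close>; the growth inequality for
  \<open>P\<close> shows that \<open>s v\<close> is the unique tilted minimizer. Tangents to the graph suffice here because a bound on the slope of a
  single-valued map at every point integrates along segments.\<close>

section \<open>Second-order expansions\<close>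

lemma C2_has_derivative:
  assumes "C2 f"
  shows "(f has_derivative (\<lambda>h. grad f x \<bullet> h)) (at x)"
proof -
  have "f differentiable at x"
    using assms by (auto simp: C2_def differentiable_on_def)
  from GDERIV_grad[OF this] show ?thesis
    by (simp add: gderiv_def inner_commute)
qed

lemma C2_grad_has_derivative:
  assumes "C2 f"
  shows "(grad f has_derivative (\<lambda>h. hess f x *v h)) (at x)"
proof -
  have "grad f differentiable at x"
    using assms by (auto simp: C2_def differentiable_on_def)
  then show ?thesis
    by (simp add: jacobian_works hess_def)
qed

lemma hess_eqI:
  assumes "(grad f has_derivative D) (at x)"
  shows "hess f x *v w = D w"
proof -
  have "grad f differentiable at x" using assms by (rule differentiableI)
  then have "(grad f has_derivative (\<lambda>h. hess f x *v h)) (at x)"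
    by (simp add: jacobian_works hess_def)
  from has_derivative_unique[OF this assms] show ?thesis by metis
qed

lemma C2_grad_tendsto:
  assumes "C2 f" "y \<longlonglongrightarrow> x"
  shows "(\<lambda>k. grad f (y k)) \<longlonglongrightarrow> grad f x"
  using has_derivative_continuous[OF C2_grad_has_derivative[OF assms(1)]] assms(2)
  by (metis isCont_tendsto_compose)

lemma C2_tendsto:
  assumes "C2 f" "y \<longlonglongrightarrow> x"
  shows "(\<lambda>k. f (y k)) \<longlonglongrightarrow> f x"
  using has_derivative_continuous[OF C2_has_derivative[OF assms(1)]] assms(2)
  by (metis isCont_tendsto_compose)

lemma difference_quotient_tendsto:
  fixes F :: "'a::real_normed_vector \<Rightarrow> 'b::real_normed_vector"
  assumes D: "(F has_derivative D) (at x)"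
    and t: "\<And>k. 0 < t k" "t \<longlonglongrightarrow> 0" and u: "u \<longlonglongrightarrow> l"
  shows "(\<lambda>k. (F (x + t k *\<^sub>R u k) - F x) /\<^sub>R t k) \<longlonglongrightarrow> D l"
proof -
  define y where "y k = t k *\<^sub>R u k" for k
  have bl: "bounded_linear D"
    using D by (rule has_derivative_bounded_linear)
  have y0: "y \<longlonglongrightarrow> 0"
    using tendsto_scaleR[OF t(2) u] by (simp add: y_def[abs_def])
  obtain M where M: "M > 0" "\<And>k. norm (u k) \<le> M"
    using convergent_imp_Bseq[OF convergentI[OF u]] unfolding Bseq_def by blast
  have "(\<lambda>k. (F (x + y k) - F x) /\<^sub>R t k - D (u k)) \<longlonglongrightarrow> 0"
  proof (rule tendstoI, unfold dist_norm diff_zero)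
    fix e :: real assume "e > 0"
    then obtain d where d: "d > 0"
      "\<And>z. norm (z - x) < d \<Longrightarrow> norm (F z - F x - D (z - x)) \<le> (e / (2 * M)) * norm (z - x)"
      using D M(1) unfolding has_derivative_within_alt by (metis UNIV_I divide_pos_pos mult_pos_pos zero_less_numeral)
    have "\<forall>\<^sub>F k in sequentially. norm (y k) < d"
      using tendstoD[OF y0 d(1)] by simp
    then show "\<forall>\<^sub>F k in sequentially. norm ((F (x + y k) - F x) /\<^sub>R t k - D (u k)) < e"
    proof eventually_elim
      case (elim k)
      have "D (y k) = t k *\<^sub>R D (u k)"
        by (simp add: y_def linear_cmul[OF bounded_linear.linear[OF bl]])
      then have "(F (x + y k) - F x) /\<^sub>R t k - D (u k) = (F (x + y k) - F x - D (y k)) /\<^sub>R t k"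
        using t(1)[of k] by (simp add: scaleR_diff_right)
      then have "norm ((F (x + y k) - F x) /\<^sub>R t k - D (u k)) = norm (F (x + y k) - F x - D (y k)) / t k"
        using t(1)[of k] by (simp add: divide_inverse_commute)
      also have "\<dots> \<le> ((e / (2 * M)) * norm (y k)) / t k"
        using d(2)[of "x + y k"] elim t(1)[of k] by (intro divide_right_mono) auto
      also have "\<dots> = (e / (2 * M)) * norm (u k)"
        using t(1)[of k] by (simp add: y_def)
      also have "\<dots> \<le> (e / (2 * M)) * M"
        using M \<open>e > 0\<close> by (intro mult_left_mono) auto
      also have "\<dots> < e"
        using M \<open>e > 0\<close> by simp
      finally show ?case .
    qed
  qed
  from tendsto_add[OF this bounded_linear.tendsto[OF bl u]] show ?thesis
    by (simp add: y_def)
qed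

text \<open>The free constant \<open>c\<close> subtracts a quadratic term along the segment, so that one mean value
  argument gives both the first-order formula (\<open>c = 0\<close>) and the remainder of the second-order
  expansion (\<open>c\<close> the Hessian form at \<open>h\<close>).\<close>

lemma mean_value_along_segment:
  assumes f: "C2 f"
  obtains s where "0 < s" "s < (1::real)"
    "f (x + h) - f x - grad f x \<bullet> h - c / 2 = (grad f (x + s *\<^sub>R h) - grad f x) \<bullet> h - s * c"
proof -
  define \<phi> where "\<phi> s = f (x + s *\<^sub>R h) - s * (grad f x \<bullet> h) - s\<^sup>2 * c / 2" for s
  have line: "((\<lambda>s. f (x + s *\<^sub>R h)) has_real_derivative grad f (x + s *\<^sub>R h) \<bullet> h) (at s)" for s
  proof -
    have "((\<lambda>s. x + s *\<^sub>R h) has_derivative (\<lambda>s. s *\<^sub>R h)) (at s)"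
      by (auto intro!: derivative_eq_intros)
    from has_derivative_compose[OF this C2_has_derivative[OF f]] show ?thesis
      by (simp add: has_field_derivative_def mult.commute[of _ "_ \<bullet> _"] fun_eq_iff)
  qed
  have der: "(\<phi> has_real_derivative (grad f (x + s *\<^sub>R h) - grad f x) \<bullet> h - s * c) (at s)" for s
    unfolding \<phi>_def by (rule derivative_eq_intros line refl | simp add: inner_diff_left)+
  obtain s where "0 < s" "s < 1" "\<phi> 1 - \<phi> 0 = (1 - 0) * ((grad f (x + s *\<^sub>R h) - grad f x) \<bullet> h - s * c)"
    using MVT2[of 0 1 \<phi> "\<lambda>s. (grad f (x + s *\<^sub>R h) - grad f x) \<bullet> h - s * c"] der by auto
  with that[of s] show ?thesis
    by (simp add: \<phi>_def)
qed

text \<open>The first-order term is taken at the moving direction \<open>u k\<close> and not at its limit: a difference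
  of order \<open>t k\<close> in the direction contributes at second order.\<close>

lemma second_order_quotient_tendsto:
  assumes f: "C2 f" and t: "\<And>k. 0 < t k" "t \<longlonglongrightarrow> 0" and u: "u \<longlonglongrightarrow> l"
  shows "(\<lambda>k. (f (x + t k *\<^sub>R u k) - f x - t k * (grad f x \<bullet> u k)) / (t k)\<^sup>2)
           \<longlonglongrightarrow> (l \<bullet> (hess f x *v l)) / 2"
proof -
  define H where "H k = u k \<bullet> (hess f x *v u k)" for k
  have "\<exists>s. 0 < s \<and> s < (1::real) \<and> 
    f (x + t k *\<^sub>R u k) - f x - grad f x \<bullet> (t k *\<^sub>R u k) - ((t k)\<^sup>2 * H k) / 2
      = (grad f (x + s *\<^sub>R t k *\<^sub>R u k) - grad f x) \<bullet> (t k *\<^sub>R u k) - s * ((t k)\<^sup>2 * H k)" for k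
    using mean_value_along_segment[OF f] by metis
  then obtain s where s: "\<And>k. 0 < s k" "\<And>k. s k < (1::real)" and
    eq: "\<And>k. f (x + t k *\<^sub>R u k) - f x - grad f x \<bullet> (t k *\<^sub>R u k) - ((t k)\<^sup>2 * H k) / 2
      = (grad f (x + s k *\<^sub>R t k *\<^sub>R u k) - grad f x) \<bullet> (t k *\<^sub>R u k) - s k * ((t k)\<^sup>2 * H k)"
    by metis
  define E where "E k = ((grad f (x + (s k * t k) *\<^sub>R u k) - grad f x) /\<^sub>R (s k * t k)) \<bullet> u k - H k" for k
  have Hl: "H \<longlonglongrightarrow> l \<bullet> (hess f x *v l)"
    unfolding H_def[abs_def]
    by (intro tendsto_inner u bounded_linear.tendsto[OF matrix_vector_mul_bounded_linear])
  have st: "(\<lambda>k. s k * t k) \<longlonglongrightarrow> 0"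
    by (rule Lim_null_comparison[OF _ t(2)])
       (use s t(1) in \<open>auto simp: abs_mult less_imp_le intro!: always_eventually mult_left_le_one_le\<close>)
  have "E \<longlonglongrightarrow> (hess f x *v l) \<bullet> l - l \<bullet> (hess f x *v l)"
    unfolding E_def[abs_def]
    by (intro tendsto_intros u Hl difference_quotient_tendsto[OF C2_grad_has_derivative[OF f] _ st u])
       (use s t in auto)
  then have E0: "E \<longlonglongrightarrow> 0"
    by (simp add: inner_commute)
  have "(\<lambda>k. s k * E k) \<longlonglongrightarrow> 0"
    by (rule Lim_null_comparison[OF _ tendsto_norm_zero[OF E0]])
       (use s in \<open>auto simp: abs_mult less_imp_le intro!: always_eventually mult_left_le_one_le\<close>)
  then have "(\<lambda>k. s k * E k + H k / 2) \<longlonglongrightarrow> 0 + (l \<bullet> (hess f x *v l)) / 2"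
    by (intro tendsto_intros Hl) auto
  moreover have "(f (x + t k *\<^sub>R u k) - f x - t k * (grad f x \<bullet> u k)) / (t k)\<^sup>2 = s k * E k + H k / 2" for k
  proof -
    have "s k * E k * (t k)\<^sup>2 = (grad f (x + (s k * t k) *\<^sub>R u k) - grad f x) \<bullet> (t k *\<^sub>R u k) - s k * ((t k)\<^sup>2 * H k)"
    proof -
      have "((d /\<^sub>R (s k * t k)) \<bullet> u k) * (s k * t k) = d \<bullet> u k" for d
        using s(1)[of k] t(1)[of k] by (auto simp: field_simps)
      then have "E k * (s k * t k) = (grad f (x + (s k * t k) *\<^sub>R u k) - grad f x) \<bullet> u k - H k * (s k * t k)"
        by (simp only: E_def left_diff_distrib)
      then have "E k * (s k * t k) * t k
          = ((grad f (x + (s k * t k) *\<^sub>R u k) - grad f x) \<bullet> u k - H k * (s k * t k)) * t k"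
        by simp
      then show ?thesis
        by (simp add: algebra_simps power2_eq_square)
    qed
    then have "f (x + t k *\<^sub>R u k) - f x - t k * (grad f x \<bullet> u k) = (s k * E k + H k / 2) * (t k)\<^sup>2"
      using eq[of k] by (simp add: algebra_simps)
    then show ?thesis
      using t(1)[of k] by (simp add: field_simps)
  qed
  ultimately show ?thesis
    by simp
qed

lemma C2_locally_quadratic:
  assumes f: "C2 (f :: real ^ 'n \<Rightarrow> real)"
  obtains C where "C \<ge> 0" and
    "\<And>x y. x \<in> cball a R \<Longrightarrow> y \<in> cball a R \<Longrightarrow> \<bar>f y - f x - grad f x \<bullet> (y - x)\<bar> \<le> C * (norm (y - x))\<^sup>2"
proof -
  have "continuous_on UNIV (hess f)"
    using f by (simp add: C2_def)
  then have "continuous_on (cball a R) (hess f)"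
    by (rule continuous_on_subset) simp
  then have "compact (hess f ` cball a R)"
    by (rule compact_continuous_image) simp
  then have "bounded (hess f ` cball a R)"
    by (rule compact_imp_bounded)
  then obtain B where "B > 0" "\<forall>A\<in>hess f ` cball a R. norm A \<le> B"
    unfolding bounded_pos by blast
  then have B: "B > 0" "\<And>x. x \<in> cball a R \<Longrightarrow> norm (hess f x) \<le> B"
    by simp_all
  define C where "C = real CARD('n) * real CARD('n) * B"
  have on: "onorm (\<lambda>h. hess f x *v h) \<le> C" if "x \<in> cball a R" for x
  proof -
    have "\<bar>hess f x $ i $ j\<bar> \<le> B" for i j
      using B(2)[OF that] component_le_norm_cart[of "hess f x $ i" j] Finite_Cartesian_Product.norm_nth_le[of "hess f x" i]
      by linarith
    then show ?thesis
      unfolding C_def by (rule onorm_le_matrix_component)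
  qed
  have lip: "norm (grad f x - grad f y) \<le> C * norm (x - y)" if "x \<in> cball a R" "y \<in> cball a R" for x y
  proof (rule differentiable_bound[where S = "cball a R"])
    show "onorm ((*v) (hess f z)) \<le> C" if "z \<in> cball a R" for z
      using on[OF that] .
    show "(grad f has_derivative (*v) (hess f z)) (at z within cball a R)" for z
      using C2_grad_has_derivative[OF f] has_derivative_at_withinI by blast
  qed (use that in auto)
  show ?thesis
  proof (rule that)
    show "C \<ge> 0" using B by (simp add: C_def)
    fix x y assume xy: "x \<in> cball a R" "y \<in> cball a R"
    obtain s where s: "0 < s" "s < (1::real)" and
      eq: "f (x + (y - x)) - f x - grad f x \<bullet> (y - x) - 0 / 2
         = (grad f (x + s *\<^sub>R (y - x)) - grad f x) \<bullet> (y - x) - s * 0"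
      using mean_value_along_segment[OF f] by metis
    have seg: "x + s *\<^sub>R (y - x) \<in> cball a R"
      using convexD_alt[OF convex_cball xy, of s] s by (simp add: algebra_simps)
    have "\<bar>f y - f x - grad f x \<bullet> (y - x)\<bar> \<le> norm (grad f (x + s *\<^sub>R (y - x)) - grad f x) * norm (y - x)"
      using eq Cauchy_Schwarz_ineq2 by simp
    also have "\<dots> \<le> (C * norm (s *\<^sub>R (y - x))) * norm (y - x)"
      using lip[OF seg xy(1)] by (intro mult_right_mono) auto
    also have "\<dots> \<le> (C * norm (y - x)) * norm (y - x)"
      using s \<open>C \<ge> 0\<close> by (intro mult_right_mono mult_left_mono) (auto simp: mult_left_le_one_le)
    finally show "\<bar>f y - f x - grad f x \<bullet> (y - x)\<bar> \<le> C * (norm (y - x))\<^sup>2"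
      by (simp add: power2_eq_square mult.assoc)
  qed
qed

section \<open>Bounded multipliers by separation\<close>

text \<open>The support function of the nonnegative vectors of norm at most \<open>r\<close> supported in \<open>J\<close> is
  \<open>r\<close> times the norm of this vector, which is also the distance of \<open>y\<close> to the polyhedral cone
  of all vectors that are nonpositive on \<open>J\<close>.\<close>

definition pos_part_on :: "'m set \<Rightarrow> real ^ 'm \<Rightarrow> real ^ 'm" where
  "pos_part_on J y = (\<chi> i. if i \<in> J then max 0 (y $ i) else 0)"

lemma pos_part_on_attains:
  fixes y :: "real ^ 'm"
  assumes "0 \<le> r"
  obtains l where "\<And>i. 0 \<le> l $ i" "\<And>i. i \<notin> J \<Longrightarrow> l $ i = 0" "norm l \<le> r"
    "l \<bullet> y = r * norm (pos_part_on J y)"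
proof
  define p where "p = pos_part_on J y"
  have pp: "p \<bullet> y = (norm p)\<^sup>2"
    unfolding power2_norm_eq_inner inner_vec_def p_def pos_part_on_def
    by (intro sum.cong) (auto simp: max_def)
  define l where "l = (r / norm p) *\<^sub>R p"
  show "0 \<le> l $ i" for i
    using assms by (simp add: l_def p_def pos_part_on_def)
  show "l $ i = 0" if "i \<notin> J" for i
    using that by (simp add: l_def p_def pos_part_on_def)
  show "norm l \<le> r"
    using assms by (simp add: l_def)
  show "l \<bullet> y = r * norm (pos_part_on J y)"
    using pp by (cases "norm p = 0") (simp_all add: l_def p_def[symmetric] power2_eq_square)
qed

lemma norm_pos_part_on_add_le:
  "norm (pos_part_on J (y + z)) \<le> norm (pos_part_on J y) + norm z"
proof -
  have "norm (pos_part_on J (y + z)) \<le> norm (pos_part_on J y + (\<chi> i. \<bar>z $ i\<bar>))"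
    by (intro norm_le_componentwise_cart) (auto simp: pos_part_on_def max_def)
  also have "\<dots> \<le> norm (pos_part_on J y) + norm (\<chi> i. \<bar>z $ i\<bar>)"
    by (rule norm_triangle_ineq)
  also have "norm (\<chi> i. \<bar>z $ i\<bar>) = norm z"
    by (simp add: norm_vec_def L2_set_def)
  finally show ?thesis .
qed

lemma pos_part_on_scaleR:
  assumes "0 \<le> t"
  shows "pos_part_on J (t *\<^sub>R y) = t *\<^sub>R pos_part_on J y"
  using assms by (auto simp: pos_part_on_def vec_eq_iff max_def mult_le_0_iff zero_le_mult_iff intro: antisym)

text \<open>A linear functional that is dominated by the violation of affine constraints is represented by
  a multiplier. Otherwise the compact convex image of the admissible multipliers is separated
  from the half-line \<open>{xs} \<times> {- \<beta>..}\<close>, and the separating functional, scaled to be a direction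
  \<open>z\<close>, violates the assumed inequality. Compactness, and with it strict separation, comes from
  the norm bound on the multipliers.\<close>

lemma bounded_multiplier_alternative:
  fixes a :: "'m::finite \<Rightarrow> 'a::euclidean_space" and b :: "real ^ 'm"
  assumes r: "0 \<le> r"
    and bound: "\<And>z. xs \<bullet> z \<le> \<beta> + r * norm (pos_part_on J ((\<chi> i. a i \<bullet> z) + b))"
  obtains l where "\<And>i. 0 \<le> l $ i" "\<And>i. i \<notin> J \<Longrightarrow> l $ i = 0" "norm l \<le> r"
    "(\<Sum>i\<in>UNIV. l $ i *\<^sub>R a i) = xs" "- \<beta> \<le> l \<bullet> b"
proof -
  define \<Lambda> where "\<Lambda> = {l::real ^ 'm. (\<forall>i. 0 \<le> l $ i) \<and> (\<forall>i. i \<notin> J \<longrightarrow> l $ i = 0) \<and> norm l \<le> r}"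
  define T where "T l = (\<Sum>i\<in>UNIV. l $ i *\<^sub>R a i, l \<bullet> b)" for l
  have linT: "linear T"
    unfolding T_def[abs_def]
    by (auto intro!: linearI simp: scaleR_add_left sum.distrib inner_add_left scaleR_sum_right)
  have \<Lambda>_eq: "\<Lambda> = (\<Inter>i. {l. 0 \<le> l $ i}) \<inter> (\<Inter>i\<in>-J. {l. l $ i = 0}) \<inter> cball 0 r"
    by (auto simp: \<Lambda>_def)
  have "closed \<Lambda>"
    unfolding \<Lambda>_eq by (intro closed_Int closed_INT closed_Collect_le closed_Collect_eq ballI continuous_intros) auto
  then have "compact \<Lambda>"
    unfolding \<Lambda>_def compact_eq_bounded_closed by (auto simp: bounded_iff)
  have "convex \<Lambda>"
  proof (rule convexI)
    fix x y :: "real ^ 'm" and u v :: real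
    assume *: "x \<in> \<Lambda>" "y \<in> \<Lambda>" "0 \<le> u" "0 \<le> v" "u + v = 1"
    then have "norm (u *\<^sub>R x + v *\<^sub>R y) \<le> r"
      using convexD[OF convex_cball[of 0 r], of x y u v] by (simp add: \<Lambda>_def)
    with * show "u *\<^sub>R x + v *\<^sub>R y \<in> \<Lambda>"
      by (simp add: \<Lambda>_def)
  qed
  define E where "E = {xs} \<times> {- \<beta>..}"
  have "T ` \<Lambda> \<inter> E \<noteq> {}"
  proof
    assume disj: "T ` \<Lambda> \<inter> E = {}"
    have "0 \<in> \<Lambda>"
      using r by (simp add: \<Lambda>_def)
    have "\<exists>A m. (\<forall>p\<in>T ` \<Lambda>. A \<bullet> p < m) \<and> (\<forall>p\<in>E. m < A \<bullet> p)"
    proof (rule separating_hyperplane_compact_closed)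
      show "convex (T ` \<Lambda>)"
        by (rule convex_linear_image[OF linT \<open>convex \<Lambda>\<close>])
      show "compact (T ` \<Lambda>)"
        using \<open>compact \<Lambda>\<close> linear_continuous_on[OF linT[unfolded linear_conv_bounded_linear]]
        by (intro compact_continuous_image)
      show "convex E" "closed E"
        unfolding E_def by (auto intro: convex_Times closed_Times)
      show "T ` \<Lambda> \<noteq> {}" using \<open>0 \<in> \<Lambda>\<close> by blast
    qed fact
    then obtain A m where sep: "\<And>l. l \<in> \<Lambda> \<Longrightarrow> A \<bullet> T l < m" "\<And>p. p \<in> E \<Longrightarrow> m < A \<bullet> p"
      by blast
    define z \<tau> where "z = fst A" and "\<tau> = snd A"
    have AT: "A \<bullet> T l = l \<bullet> ((\<chi> i. a i \<bullet> z) + \<tau> *\<^sub>R b)" for l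
    proof -
      have "z \<bullet> (\<Sum>i\<in>UNIV. l $ i *\<^sub>R a i) = l \<bullet> (\<chi> i. a i \<bullet> z)"
        by (simp add: inner_sum_right inner_vec_def inner_commute)
      then show ?thesis
        by (simp add: T_def inner_prod_def inner_add_right flip: z_def \<tau>_def)
    qed
    have upper: "r * norm (pos_part_on J ((\<chi> i. a i \<bullet> z) + \<tau> *\<^sub>R b)) < m"
    proof -
      obtain l where "\<And>i. 0 \<le> l $ i" "\<And>i. i \<notin> J \<Longrightarrow> l $ i = 0" "norm l \<le> r"
        and eq: "l \<bullet> ((\<chi> i. a i \<bullet> z) + \<tau> *\<^sub>R b) = r * norm (pos_part_on J ((\<chi> i. a i \<bullet> z) + \<tau> *\<^sub>R b))"
        using pos_part_on_attains[OF r] by blast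
      then have "l \<in> \<Lambda>" by (simp add: \<Lambda>_def)
      from sep(1)[OF this] show ?thesis by (simp only: AT eq)
    qed
    have lower: "m < z \<bullet> xs + \<tau> * s" if "- \<beta> \<le> s" for s
      using sep(2)[of "(xs, s)"] that by (simp add: E_def z_def \<tau>_def inner_prod_def)
    \<comment> \<open>the half-line is unbounded above, which fixes the sign of the separating functional on it\<close>
    have "0 \<le> \<tau>"
    proof (rule ccontr)
      assume "\<not> 0 \<le> \<tau>"
      define s where "s = max (- \<beta>) ((m - z \<bullet> xs) / \<tau>)"
      have "\<tau> * s \<le> \<tau> * ((m - z \<bullet> xs) / \<tau>)"
        using \<open>\<not> 0 \<le> \<tau>\<close> by (intro mult_left_mono_neg) (auto simp: s_def)
      then show False
        using lower[of s] \<open>\<not> 0 \<le> \<tau>\<close> by (simp add: s_def)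
    qed
    show False
    proof (cases "\<tau> = 0")
      case False
      then have "\<tau> > 0" using \<open>0 \<le> \<tau>\<close> by simp
      have "(\<chi> i. a i \<bullet> z) + \<tau> *\<^sub>R b = \<tau> *\<^sub>R ((\<chi> i. a i \<bullet> (z /\<^sub>R \<tau>)) + b)"
        using \<open>\<tau> > 0\<close> by (simp add: vec_eq_iff field_simps)
      then have "norm (pos_part_on J ((\<chi> i. a i \<bullet> z) + \<tau> *\<^sub>R b))
          = \<tau> * norm (pos_part_on J ((\<chi> i. a i \<bullet> (z /\<^sub>R \<tau>)) + b))"
        using \<open>\<tau> > 0\<close> by (simp add: pos_part_on_scaleR)
      with upper lower[of "- \<beta>"] have "\<tau> * (r * norm (pos_part_on J ((\<chi> i. a i \<bullet> (z /\<^sub>R \<tau>)) + b)))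
          < z \<bullet> xs - \<tau> * \<beta>"
        by (simp add: algebra_simps)
      also have "\<dots> = \<tau> * (xs \<bullet> (z /\<^sub>R \<tau>) - \<beta>)"
        using \<open>\<tau> > 0\<close> by (simp add: field_simps inner_commute)
      finally show False
        using bound[of "z /\<^sub>R \<tau>"] \<open>\<tau> > 0\<close> by simp
    next
      case True
      \<comment> \<open>a vertical hyperplane: the assumed inequality fails for large multiples of \<open>z\<close>\<close>
      define \<delta> where "\<delta> = xs \<bullet> z - r * norm (pos_part_on J (\<chi> i. a i \<bullet> z))"
      have "\<delta> > 0"
        using upper lower[of "- \<beta>"] True by (simp add: \<delta>_def inner_commute)
      have "k * \<delta> \<le> \<beta> + r * norm b" if "k \<ge> 0" for k
      proof -
        have "(\<chi> i. a i \<bullet> (k *\<^sub>R z)) = k *\<^sub>R (\<chi> i. a i \<bullet> z)"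
          by (simp add: vec_eq_iff)
        then have "k * (xs \<bullet> z) \<le> \<beta> + r * norm (pos_part_on J (k *\<^sub>R (\<chi> i. a i \<bullet> z) + b))"
          using bound[of "k *\<^sub>R z"] by simp
        also have "\<dots> \<le> \<beta> + r * (norm (pos_part_on J (k *\<^sub>R (\<chi> i. a i \<bullet> z))) + norm b)"
          using r by (intro add_left_mono mult_left_mono norm_pos_part_on_add_le)
        also have "\<dots> = \<beta> + r * norm b + k * (r * norm (pos_part_on J (\<chi> i. a i \<bullet> z)))"
          using that by (simp add: pos_part_on_scaleR algebra_simps)
        finally show ?thesis by (simp add: \<delta>_def algebra_simps)
      qed
      from this[of "(\<bar>\<beta> + r * norm b\<bar> + 1) / \<delta>"] \<open>\<delta> > 0\<close> show False
        by simp
    qed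
  qed
  then obtain l where "l \<in> \<Lambda>" "T l \<in> E"
    by blast
  then show ?thesis
    by (intro that[of l]) (auto simp: \<Lambda>_def T_def E_def)
qed

section \<open>Lipschitz solution maps of tilted minimization\<close>

text \<open>The optimal value \<open>\<theta> w = w \<bullet> s w - f (s w)\<close> is the convex conjugate of \<open>f\<close> on \<open>S\<close>, and \<open>s w\<close> is a
  subgradient of it at \<open>w\<close>. A \<open>\<kappa>\<close>-Lipschitz gradient makes \<open>\<theta>\<close> lie below its tangent plus
  \<open>\<kappa> \<parallel>d\<parallel>\<^sup>2 / 2\<close>; since \<open>f y \<ge> w \<bullet> y - \<theta> w\<close> for every \<open>w\<close>, the choice \<open>w = v + (y - s v) / \<kappa>\<close>
  gives the growth of \<open>f\<close>. The upper estimate for \<open>\<theta>\<close> comes from summing the subgradient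
  inequality over \<open>n\<close> equal steps, which gives it up to a factor \<open>1 + 1 / n\<close>.\<close>

lemma argmin_quadratic_growth:
  fixes f :: "'a::real_inner \<Rightarrow> real" and s :: "'a \<Rightarrow> 'a"
  assumes argmin: "\<And>v. v \<in> V \<Longrightarrow> s v \<in> S"
      "\<And>v y. v \<in> V \<Longrightarrow> y \<in> S \<Longrightarrow> f (s v) - v \<bullet> s v \<le> f y - v \<bullet> y"
    and lip: "\<kappa>-lipschitz_on V s" and "0 < \<kappa>" and "convex V"
    and v: "v \<in> V" and y: "y \<in> S" and shift: "v + (y - s v) /\<^sub>R \<kappa> \<in> V"
  shows "f (s v) + v \<bullet> (y - s v) + (norm (y - s v))\<^sup>2 / (2 * \<kappa>) \<le> f y"
proof -
  define \<theta> where "\<theta> w = w \<bullet> s w - f (s w)" for w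
  define d where "d = (y - s v) /\<^sub>R \<kappa>"
  define D where "D = s v \<bullet> d" 
  define K where "K = \<kappa> * (norm d)\<^sup>2"
  have subgrad: "\<theta> w' - \<theta> w \<le> s w' \<bullet> (w' - w)" if "w \<in> V" "w' \<in> V" for w w'
    using argmin(2)[OF that(1) argmin(1)[OF that(2)]]
    by (simp add: \<theta>_def inner_diff_right inner_commute)
  have inV: "v + t *\<^sub>R d \<in> V" if "0 \<le> t" "t \<le> 1" for t
    using convexD_alt[OF \<open>convex V\<close> v shift, of t] that
    by (simp add: d_def algebra_simps)
  have step: "\<theta> (v + t' *\<^sub>R d) - \<theta> (v + t *\<^sub>R d) \<le> (t' - t) * (D + t' * K)"
    if "0 \<le> t" "t \<le> t'" "t' \<le> 1" for t t'
  proof -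
    have "\<theta> (v + t' *\<^sub>R d) - \<theta> (v + t *\<^sub>R d) \<le> s (v + t' *\<^sub>R d) \<bullet> ((t' - t) *\<^sub>R d)"
      using subgrad[OF inV inV, of t t'] that by (simp add: algebra_simps)
    also have "\<dots> = (t' - t) * (D + (s (v + t' *\<^sub>R d) - s v) \<bullet> d)"
      by (simp add: D_def inner_diff_left)
    also have "\<dots> \<le> (t' - t) * (D + t' * K)"
    proof -
      have "norm (s (v + t' *\<^sub>R d) - s v) \<le> \<kappa> * (t' * norm d)"
        using lipschitz_onD[OF lip inV[of t'] v] that by (simp add: dist_norm)
      then have "(s (v + t' *\<^sub>R d) - s v) \<bullet> d \<le> (\<kappa> * (t' * norm d)) * norm d"
        by (meson Cauchy_Schwarz_ineq2 abs_le_D1 mult_right_mono norm_ge_zero order_trans)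
      then show ?thesis
        using that by (intro mult_left_mono) (auto simp: K_def power2_eq_square mult.commute mult.left_commute)
    qed
    finally show ?thesis .
  qed
  have descent: "\<theta> (v + d) - \<theta> v \<le> D + (1 + 1 / real (Suc N)) * K / 2" for N
  proof -
    define n where "n = real (Suc N)"
    have "j \<le> Suc N \<Longrightarrow> \<theta> (v + (real j / n) *\<^sub>R d) - \<theta> v \<le> (real j / n) * D + (real j * (real j + 1) / (2 * n\<^sup>2)) * K" for j
    proof (induction j)
      case (Suc j)
      have "n > 0" "real j + 1 \<le> n" using Suc.prems by (auto simp: n_def)
      then have "\<theta> (v + (real (Suc j) / n) *\<^sub>R d) - \<theta> (v + (real j / n) *\<^sub>R d)
          \<le> (real (Suc j) / n - real j / n) * (D + (real (Suc j) / n) * K)"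
        by (intro step) (auto simp: divide_simps)
      also have "real (Suc j) / n - real j / n = 1 / n"
        by (simp add: diff_divide_distrib[symmetric])
      finally have "\<theta> (v + (real (Suc j) / n) *\<^sub>R d) - \<theta> v
          \<le> (1 / n) * (D + (real (Suc j) / n) * K) + ((real j / n) * D + (real j * (real j + 1) / (2 * n\<^sup>2)) * K)"
        using Suc.IH Suc.prems by linarith
      also have "\<dots> = (real (Suc j) / n) * D + (real (Suc j) * (real (Suc j) + 1) / (2 * n\<^sup>2)) * K"
        using \<open>n > 0\<close> by (simp add: field_simps power2_eq_square)
      finally show ?case .
    qed simp
    moreover have "n > 0" "real (Suc N) = n" by (simp_all add: n_def)
    moreover from \<open>n > 0\<close> have "n * (n + 1) / (2 * n\<^sup>2) = (1 + 1 / n) / 2"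
      by (simp add: field_simps power2_eq_square)
    ultimately show ?thesis
      by (metis (no_types, lifting) divide_self_if mult_1 order_refl order_less_irrefl scaleR_one times_divide_eq_left)
  qed
  have "(\<lambda>N. D + (1 + 1 / real (Suc N)) * K / 2) \<longlonglongrightarrow> D + (1 + 0) * K / 2"
    by (intro tendsto_intros lim_inverse_n'[THEN LIMSEQ_Suc]) auto
  then have "\<theta> (v + d) - \<theta> v \<le> D + (1 + 0) * K / 2"
    by (rule LIMSEQ_le_const) (use descent in auto)
  moreover have "(v + d) \<bullet> y - \<theta> (v + d) \<le> f y"
    using argmin(2)[OF shift y] by (simp add: \<theta>_def d_def)
  moreover have "d \<bullet> y - d \<bullet> s v = 2 * ((norm (y - s v))\<^sup>2 / (2 * \<kappa>))"
  proof -
    have "d \<bullet> y - d \<bullet> s v = inverse \<kappa> * ((y - s v) \<bullet> (y - s v))"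
      by (simp only: d_def inner_scaleR_left inner_diff_right right_diff_distrib)
    also have "\<dots> = 2 * ((y - s v) \<bullet> (y - s v) / (2 * \<kappa>))"
      using \<open>0 < \<kappa>\<close> by (simp add: field_simps)
    finally show ?thesis
      by (simp only: power2_norm_eq_inner)
  qed
  moreover have "K = 2 * ((norm (y - s v))\<^sup>2 / (2 * \<kappa>))"
  proof -
    have "norm d = norm (y - s v) / \<kappa>"
      unfolding d_def norm_scaleR using \<open>0 < \<kappa>\<close> by (simp add: field_simps)
    then show ?thesis
      using \<open>0 < \<kappa>\<close> by (simp add: K_def power_divide power2_eq_square)
  qed
  moreover have "\<theta> (v + d) - \<theta> v = (v + d) \<bullet> s (v + d) - f (s (v + d)) - v \<bullet> s v + f (s v)"
    by (simp add: \<theta>_def)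
  moreover have "(v + d) \<bullet> y - \<theta> (v + d) = v \<bullet> y + d \<bullet> y - (v + d) \<bullet> s (v + d) + f (s (v + d))"
    by (simp add: \<theta>_def inner_add_left)
  ultimately show ?thesis
    by (simp add: D_def inner_diff_right inner_commute[of "s v" d])
qed

text \<open>Brouwer's theorem applied to \<open>w \<mapsto> z - r s w\<close>, followed by the projection to the ball, gives a fixed
  point; monotonicity keeps it in the region where the projection does nothing.\<close>

lemma monotone_plus_identity_solvable:
  fixes s :: "'a::euclidean_space \<Rightarrow> 'a"
  assumes cont: "continuous_on (cball 0 e) s"
    and mono: "\<And>w. w \<in> cball 0 e \<Longrightarrow> 0 \<le> (s w - s 0) \<bullet> w"
    and r: "0 \<le> r" and z: "norm (z - r *\<^sub>R s 0) < e"
  obtains w where "w \<in> cball 0 e" "w + r *\<^sub>R s w = z"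
proof -
  define \<pi> where "\<pi> = closest_point (cball (0::'a) e)"
  have "e > 0" using z by (meson le_less_trans norm_ge_zero)
  obtain w where w: "w \<in> cball 0 e" "\<pi> (z - r *\<^sub>R s w) = w"
  proof (rule brouwer[of "cball 0 e" "\<lambda>w. \<pi> (z - r *\<^sub>R s w)"])
    have "continuous_on UNIV \<pi>"
      unfolding \<pi>_def using \<open>e > 0\<close> by (intro continuous_on_closest_point) auto
    then show "continuous_on (cball 0 e) (\<lambda>w. \<pi> (z - r *\<^sub>R s w))"
      by (rule continuous_on_compose2) (auto intro!: continuous_intros cont)
    show "(\<lambda>w. \<pi> (z - r *\<^sub>R s w)) \<in> cball 0 e \<rightarrow> cball 0 e"
      using closest_point_in_set[of "cball (0::'a) e"] \<open>e > 0\<close> by (auto simp: \<pi>_def)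
  qed (use \<open>e > 0\<close> in auto)
  define p where "p = z - r *\<^sub>R s w"
  have "p = w"
  proof (rule ccontr)
    assume "p \<noteq> w"
    have \<pi>p: "\<pi> p = w" using w by (simp add: p_def)
    have dot: "(p - w) \<bullet> (y - w) \<le> 0" if "y \<in> cball 0 e" for y
      using closest_point_dot[of "cball 0 e" y p] that \<pi>p by (simp add: \<pi>_def)
    have "norm w = e"
    proof (rule ccontr)
      assume "norm w \<noteq> e"
      then have "norm w < e" using w(1) by simp
      define \<tau> where "\<tau> = (e - norm w) / norm (p - w)"
      have "\<tau> > 0" using \<open>norm w < e\<close> \<open>p \<noteq> w\<close> by (simp add: \<tau>_def)
      have "norm (w + \<tau> *\<^sub>R (p - w)) \<le> norm w + \<tau> * norm (p - w)"
        using norm_triangle_ineq[of w "\<tau> *\<^sub>R (p - w)"] \<open>\<tau> > 0\<close> by simp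
      also have "\<dots> = e" using \<open>p \<noteq> w\<close> by (simp add: \<tau>_def)
      finally have "(p - w) \<bullet> (\<tau> *\<^sub>R (p - w)) \<le> 0"
        using dot[of "w + \<tau> *\<^sub>R (p - w)"] by simp
      moreover have "0 < (p - w) \<bullet> (p - w)" using \<open>p \<noteq> w\<close> by simp
      ultimately show False using \<open>\<tau> > 0\<close> by (simp add: mult_le_0_iff)
    qed
    have "e * e \<le> p \<bullet> w"
      using dot[of 0] \<open>e > 0\<close> \<open>norm w = e\<close>
      by (simp add: inner_diff_left power2_norm_eq_inner[symmetric] power2_eq_square)
    also have "p \<bullet> w \<le> (z - r *\<^sub>R s 0) \<bullet> w"
      using mult_left_mono[OF mono[OF w(1)] r] by (simp add: p_def inner_diff_left algebra_simps)
    also have "\<dots> \<le> norm (z - r *\<^sub>R s 0) * e"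
      using norm_cauchy_schwarz[of "z - r *\<^sub>R s 0" w] \<open>norm w = e\<close> by simp
    also have "\<dots> < e * e"
      using z \<open>e > 0\<close> by simp
    finally show False by simp
  qed
  then have "w + r *\<^sub>R s w = z"
    by (metis p_def diff_add_cancel)
  with w(1) that show ?thesis
    by blast
qed

text \<open>Bisection along a segment: a slope estimate between two points follows from the estimates on the
  two halves, and on short intervals around a point it holds by assumption.\<close>

lemma lipschitz_if_pointwise_slope_bound:
  fixes P :: "'a::real_normed_vector \<Rightarrow> 'b::metric_space"
  assumes "convex B" and "0 \<le> L"
    and slope: "\<And>z L'. z \<in> B \<Longrightarrow> L < L' \<Longrightarrow>
      \<exists>d>0. \<forall>z'\<in>B. dist z' z < d \<longrightarrow> dist (P z') (P z) \<le> L' * dist z' z"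
  shows "L-lipschitz_on B P"
proof (rule lipschitz_onI[OF _ \<open>0 \<le> L\<close>])
  fix a b assume ab: "a \<in> B" "b \<in> B"
  show "dist (P a) (P b) \<le> L * dist a b"
  proof (cases "a = b")
    case False
    then have "dist a b > 0" by simp
    have bound: "dist (P a) (P b) \<le> L' * dist a b" if "L < L'" for L'
    proof -
      define c where "c t = a + t *\<^sub>R (b - a)" for t :: real
      have cB: "c t \<in> B" if "0 \<le> t" "t \<le> 1" for t
        using convexD_alt[OF \<open>convex B\<close> ab, of t] that by (simp add: c_def algebra_simps)
      have dc: "dist (c t) (c t') = \<bar>t - t'\<bar> * dist a b" for t t'
        by (simp add: c_def dist_norm scaleR_diff_left[symmetric] norm_minus_commute)
      define Q where "Q t t' \<longleftrightarrow> (0 \<le> t \<longrightarrow> t \<le> t' \<longrightarrow> t' \<le> 1 \<longrightarrow> dist (P (c t)) (P (c t')) \<le> L' * ((t' - t) * dist a b))" for t t'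
      have "Q 0 1"
      proof (rule Bolzano)
        fix t1 t2 t3 assume "Q t1 t2" "Q t2 t3" "t1 \<le> t2" "t2 \<le> t3"
        then show "Q t1 t3"
          unfolding Q_def
          using dist_triangle[of "P (c t1)" "P (c t3)" "P (c t2)"] by (auto simp: algebra_simps)
      next
        fix x :: real assume x: "0 \<le> x" "x \<le> 1"
        obtain d where d: "d > 0" "\<And>z'. z' \<in> B \<Longrightarrow> dist z' (c x) < d \<Longrightarrow> dist (P z') (P (c x)) \<le> L' * dist z' (c x)"
          using slope[OF cB[OF x] \<open>L < L'\<close>] by blast
        show "\<exists>d>0. \<forall>t t'. t \<le> x \<and> x \<le> t' \<and> t' - t < d \<longrightarrow> Q t t'"
        proof (intro exI conjI allI impI)
          show "d / dist a b > 0" using d \<open>dist a b > 0\<close> by simp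
          fix t t' assume tt: "t \<le> x \<and> x \<le> t' \<and> t' - t < d / dist a b"
          show "Q t t'"
            unfolding Q_def
          proof (intro impI)
            assume "0 \<le> t" "t \<le> t'" "t' \<le> 1"
            have "(t' - t) * dist a b < d"
              using tt \<open>dist a b > 0\<close> by (simp add: pos_less_divide_eq)
            moreover have "(x - t) * dist a b \<le> (t' - t) * dist a b" "(t' - x) * dist a b \<le> (t' - t) * dist a b"
              using tt by (auto intro!: mult_right_mono)
            ultimately have "dist (P (c t)) (P (c x)) \<le> L' * ((x - t) * dist a b)"
              "dist (P (c t')) (P (c x)) \<le> L' * ((t' - x) * dist a b)"
              using d(2)[OF cB[of t]] d(2)[OF cB[of t']] tt \<open>0 \<le> t\<close> \<open>t' \<le> 1\<close> x by (auto simp: dc)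
            then have "dist (P (c t)) (P (c t')) \<le> L' * ((x - t) * dist a b) + L' * ((t' - x) * dist a b)"
              using dist_triangle2[of "P (c t)" "P (c t')" "P (c x)"] by linarith
            then show "dist (P (c t)) (P (c t')) \<le> L' * ((t' - t) * dist a b)"
              by (simp add: algebra_simps)
          qed
        qed
      qed simp
      then show ?thesis by (simp add: Q_def c_def)
    qed
    show ?thesis
    proof (rule field_le_epsilon)
      fix e :: real assume "e > 0"
      then show "dist (P a) (P b) \<le> L * dist a b + e"
        using bound[of "L + e / dist a b"] \<open>dist a b > 0\<close> by (simp add: field_simps)
    qed
  qed simp
qed

section \<open>Smooth programs in coordinates\<close>

lemma norm_add_scaleR_le:
  fixes a b :: "'a::real_normed_vector"
  assumes "0 \<le> r"
  shows "norm (a + r *\<^sub>R b) \<le> norm a + r * norm b"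
  using norm_triangle_ineq[of a "r *\<^sub>R b"] assms by simp

lemma cball_cluster_point:
  fixes u :: "nat \<Rightarrow> 'a::euclidean_space"
  assumes "\<And>k. norm (u k) \<le> B"
  obtains l \<sigma> where "strict_mono \<sigma>" "(u \<circ> \<sigma>) \<longlonglongrightarrow> l" "norm l \<le> B"
proof -
  have "\<forall>k. u k \<in> cball 0 B" using assms by simp
  then obtain l \<sigma> where "l \<in> cball 0 B" "strict_mono \<sigma>" "(u \<circ> \<sigma>) \<longlonglongrightarrow> l"
    using compact_cball[of "0::'a" B] unfolding compact_def by meson
  then show ?thesis using that by simp
qed

locale smooth_program =
  fixes g :: "real ^ 'n \<Rightarrow> real" and q :: "real ^ 'n \<Rightarrow> real ^ 'm"
  assumes C2_g: "C2 g" and C2_q: "\<And>i. C2 (\<lambda>x. q x $ i)"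
begin

abbreviation "\<Gamma> \<equiv> feasible_set q"

definition dq :: "'m \<Rightarrow> real ^ 'n \<Rightarrow> real ^ 'n" where
  "dq i x = grad (\<lambda>y. q y $ i) x"

definition qcurv :: "'m \<Rightarrow> real ^ 'n \<Rightarrow> real ^ 'n \<Rightarrow> real" where
  "qcurv i x w = w \<bullet> (hess (\<lambda>y. q y $ i) x *v w)"

definition gcurv :: "real ^ 'n \<Rightarrow> real ^ 'n \<Rightarrow> real" where
  "gcurv x w = w \<bullet> (hess g x *v w)"

lemma grad_sum:
  "grad (\<lambda>y. l \<bullet> q y) = (\<lambda>x. \<Sum>i\<in>UNIV. l $ i *\<^sub>R dq i x)"
proof
  fix x
  have "((\<lambda>y. \<Sum>i\<in>UNIV. l $ i * q y $ i) has_derivative (\<lambda>h. \<Sum>i\<in>UNIV. l $ i * (dq i x \<bullet> h))) (at x)"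
    unfolding dq_def
    by (intro has_derivative_sum has_derivative_mult_right C2_has_derivative[OF C2_q])
  then have "GDERIV (\<lambda>y. l \<bullet> q y) x :> (\<Sum>i\<in>UNIV. l $ i *\<^sub>R dq i x)"
    by (simp add: gderiv_def inner_vec_def[where 'a=real and 'b='m] inner_sum_right inner_commute)
  then show "grad (\<lambda>y. l \<bullet> q y) x = (\<Sum>i\<in>UNIV. l $ i *\<^sub>R dq i x)"
    by (rule grad_eqI)
qed

lemma grad_sum_has_derivative:
  "((\<lambda>x. \<Sum>i\<in>UNIV. l $ i *\<^sub>R dq i x) has_derivative
     (\<lambda>h. \<Sum>i\<in>UNIV. l $ i *\<^sub>R (hess (\<lambda>y. q y $ i) x *v h))) (at x)"
  unfolding dq_def
  by (intro has_derivative_sum has_derivative_scaleR_right C2_grad_has_derivative[OF C2_q])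

lemma hess_multiplier_form:
  "w \<bullet> (hess (\<lambda>y. l \<bullet> q y) x *v w) = (\<Sum>i\<in>UNIV. l $ i * qcurv i x w)"
proof -
  have "hess (\<lambda>y. l \<bullet> q y) x *v w = (\<Sum>i\<in>UNIV. l $ i *\<^sub>R (hess (\<lambda>y. q y $ i) x *v w))"
    by (rule hess_eqI) (simp add: grad_sum grad_sum_has_derivative)
  then show ?thesis
    by (simp add: inner_sum_right qcurv_def)
qed

lemma grad_Lagr:
  "grad (\<lambda>y. Lagr g q y l) = (\<lambda>x. grad g x + (\<Sum>i\<in>UNIV. l $ i *\<^sub>R dq i x))"
proof
  fix x
  have "((\<lambda>y. \<Sum>i\<in>UNIV. l $ i * q y $ i) has_derivative (\<lambda>h. \<Sum>i\<in>UNIV. l $ i * (dq i x \<bullet> h))) (at x)"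
    unfolding dq_def
    by (intro has_derivative_sum has_derivative_mult_right C2_has_derivative[OF C2_q])
  from has_derivative_add[OF C2_has_derivative[OF C2_g] this]
  have "GDERIV (\<lambda>y. Lagr g q y l) x :> (grad g x + (\<Sum>i\<in>UNIV. l $ i *\<^sub>R dq i x))"
    by (simp add: Lagr_def gderiv_def inner_vec_def[where 'a=real and 'b='m] inner_sum_right inner_add_right inner_commute)
  then show "grad (\<lambda>y. Lagr g q y l) x = grad g x + (\<Sum>i\<in>UNIV. l $ i *\<^sub>R dq i x)"
    by (rule grad_eqI)
qed

lemma hess_Lagr_form:
  "(hess (\<lambda>y. Lagr g q y l) x *v w) \<bullet> w = gcurv x w + (\<Sum>i\<in>UNIV. l $ i * qcurv i x w)"
proof -
  have "hess (\<lambda>y. Lagr g q y l) x *v w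
      = hess g x *v w + (\<Sum>i\<in>UNIV. l $ i *\<^sub>R (hess (\<lambda>y. q y $ i) x *v w))"
    by (rule hess_eqI)
       (unfold grad_Lagr, intro has_derivative_add C2_grad_has_derivative[OF C2_g] grad_sum_has_derivative)
  then show ?thesis
    by (simp add: inner_add_right inner_sum_right qcurv_def gcurv_def inner_commute)
qed

lemma multipliers_iff:
  "l \<in> multipliers q x xs \<longleftrightarrow> (\<forall>i. 0 \<le> l $ i) \<and> (\<forall>i. i \<notin> active q x \<longrightarrow> l $ i = 0)
     \<and> (\<Sum>i\<in>UNIV. l $ i *\<^sub>R dq i x) = xs"
proof -
  have D: "(q has_derivative (\<lambda>h. \<chi> i. dq i x \<bullet> h)) (at x)"
    unfolding has_derivative_componentwise_within[of q]
    by (auto simp: Basis_vec_def inner_axis dq_def intro: C2_has_derivative[OF C2_q])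
  have "jacobian q (at x) *v h = (\<chi> i. dq i x \<bullet> h)" for h
    using has_derivative_unique[OF _ D] jacobian_works[of q "at x"] D
    by (metis differentiableI)
  then have J: "jacobian q (at x) *v h = (\<chi> i. dq i x \<bullet> h)" for h .
  have "(transpose (jacobian q (at x)) *v l) \<bullet> h = (\<Sum>i\<in>UNIV. l $ i *\<^sub>R dq i x) \<bullet> h" for h
  proof -
    have "(transpose (jacobian q (at x)) *v l) \<bullet> h = l \<bullet> (jacobian q (at x) *v h)"
      by (simp only: transpose_matrix_vector dot_lmul_matrix)
    also have "\<dots> = (\<Sum>i\<in>UNIV. l $ i *\<^sub>R dq i x) \<bullet> h"
      by (simp add: J inner_sum_left inner_vec_def[where 'a=real and 'b='m])
    finally show ?thesis .
  qed
  then have "transpose (jacobian q (at x)) *v l = (\<Sum>i\<in>UNIV. l $ i *\<^sub>R dq i x)"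
    by (metis vector_eq_rdot)
  then show ?thesis
    by (auto simp: multipliers_def nonneg_orthant_def)
qed

lemma feasible_iff: "x \<in> \<Gamma> \<longleftrightarrow> (\<forall>i. q x $ i \<le> 0)"
  by (simp add: feasible_set_def)

lemma q_tendsto: "y \<longlonglongrightarrow> x \<Longrightarrow> (\<lambda>k. q (y k) $ i) \<longlonglongrightarrow> q x $ i"
  by (rule C2_tendsto[OF C2_q])

lemma dq_tendsto: "y \<longlonglongrightarrow> x \<Longrightarrow> (\<lambda>k. dq i (y k)) \<longlonglongrightarrow> dq i x"
  unfolding dq_def by (rule C2_grad_tendsto[OF C2_q])

lemma closed_feasible: "closed \<Gamma>"
  unfolding closed_sequential_limits
proof (intro allI impI, elim conjE)
  fix y x assume y: "\<forall>k. y k \<in> \<Gamma>" "y \<longlonglongrightarrow> x"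
  show "x \<in> \<Gamma>"
    unfolding feasible_iff
    using LIMSEQ_le_const2[OF q_tendsto[OF y(2)]] y(1) by (auto simp: feasible_iff)
qed

definition ineqs_curv :: "real ^ 'n \<Rightarrow> real ^ 'n \<Rightarrow> real ^ 'm" where
  "ineqs_curv x u = (\<chi> i. qcurv i x u)"

text \<open>The constraints whose second-order behaviour decides whether an arc leaving \<open>x\<close> in the direction
  \<open>u\<close> stays feasible.\<close>

definition flat_actives :: "real ^ 'n \<Rightarrow> real ^ 'n \<Rightarrow> 'm set" where
  "flat_actives x u = {i. i \<in> active q x \<and> dq i x \<bullet> u = 0}"

end

section \<open>Feasible arcs and multipliers under metric subregularity\<close>

locale subregular_program = smooth_program g q for g :: "real ^ 'n \<Rightarrow> real" and q :: "real ^ 'n \<Rightarrow> real ^ 'm" +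
  fixes U :: "(real ^ 'n) set" and c :: real
  assumes open_U: "open U" and c_pos: "0 < c"
    and error_bound: "\<And>x. x \<in> U \<Longrightarrow> infdist x \<Gamma> \<le> c * infdist (q x) nonpos_orthant"
begin

text \<open>Along \<open>x + t u + (t\<^sup>2 / 2) z\<close> the constraints that are inactive at \<open>x\<close>, or active and strictly
  decreasing along \<open>u\<close>, stay satisfied for small \<open>t\<close>; only \<open>flat_actives x u\<close> can be violated, and by
  \<open>t\<^sup>2 / 2\<close> times the positive part of their second-order term. The error bound moves the curve into
  \<open>\<Gamma>\<close> by at most \<open>c\<close> times that, up to \<open>o(t\<^sup>2)\<close>. For \<open>u = 0\<close> this is the first-order
  statement on tangents, with \<open>t\<^sup>2 / 2\<close> as step size.\<close>

lemma feasible_arc: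
  assumes x: "x \<in> \<Gamma>" "x \<in> U"
    and u: "\<And>i. i \<in> active q x \<Longrightarrow> dq i x \<bullet> u \<le> 0"
  obtains t z' zl where "\<And>k::nat. 0 < t k" "t \<longlonglongrightarrow> 0" "z' \<longlonglongrightarrow> zl"
    "\<And>k. x + t k *\<^sub>R u + ((t k)\<^sup>2 / 2) *\<^sub>R z' k \<in> \<Gamma>"
    "norm (zl - z) \<le> c * norm (pos_part_on (flat_actives x u) ((\<chi> i. dq i x \<bullet> z) + ineqs_curv x u))"
proof -
  define y where "y = (\<chi> i. dq i x \<bullet> z) + ineqs_curv x u"
  define p where "p = pos_part_on (flat_actives x u) y"
  define t0 where "t0 k = inverse (real (Suc k))" for k
  have t0: "\<And>k. 0 < t0 k" "t0 \<longlonglongrightarrow> 0"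
    using LIMSEQ_inverse_real_of_nat by (simp_all add: t0_def[abs_def] del: of_nat_Suc)
  define h where "h k = u + (t0 k / 2) *\<^sub>R z" for k
  have hl: "h \<longlonglongrightarrow> u + (0 / 2) *\<^sub>R z"
    unfolding h_def[abs_def] by (intro tendsto_intros t0) auto
  then have hl: "h \<longlonglongrightarrow> u" by simp
  define X where "X k = x + t0 k *\<^sub>R h k" for k
  have "X \<longlonglongrightarrow> x + 0 *\<^sub>R u"
    unfolding X_def[abs_def] by (intro tendsto_intros t0 hl)
  then have Xl: "X \<longlonglongrightarrow> x" by simp
  \<comment> \<open>a point of the nonpositive orthant near \<open>q (X k)\<close>: the second-order model with the flat violations removed\<close>
  define m where "m k = (\<chi> i. q x $ i + t0 k * (dq i x \<bullet> u) + (t0 k)\<^sup>2 / 2 * (y $ i - p $ i))" for k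
  define e where "e k = (\<chi> i. (q (X k) $ i - q x $ i - t0 k * (dq i x \<bullet> u) - (t0 k)\<^sup>2 / 2 * (y $ i)) / (t0 k)\<^sup>2)" for k
  have e0: "e \<longlonglongrightarrow> 0"
  proof (rule vec_tendstoI)
    fix i
    have "(\<lambda>k. (q (x + t0 k *\<^sub>R h k) $ i - q x $ i - t0 k * (dq i x \<bullet> h k)) / (t0 k)\<^sup>2) \<longlonglongrightarrow> qcurv i x u / 2"
      unfolding qcurv_def dq_def by (rule second_order_quotient_tendsto[OF C2_q t0 hl])
    then have "(\<lambda>k. (q (x + t0 k *\<^sub>R h k) $ i - q x $ i - t0 k * (dq i x \<bullet> h k)) / (t0 k)\<^sup>2 - qcurv i x u / 2) \<longlonglongrightarrow> qcurv i x u / 2 - qcurv i x u / 2"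
      by (rule tendsto_diff[OF _ tendsto_const])
    moreover have "e k $ i = (q (x + t0 k *\<^sub>R h k) $ i - q x $ i - t0 k * (dq i x \<bullet> h k)) / (t0 k)\<^sup>2 - qcurv i x u / 2" for k
      using t0(1)[of k]
      by (simp add: e_def X_def h_def y_def ineqs_curv_def inner_add_right field_simps power2_eq_square)
    ultimately show "(\<lambda>k. e k $ i) \<longlonglongrightarrow> 0 $ i"
      by simp
  qed
  have m_nonpos: "\<forall>\<^sub>F k in sequentially. \<forall>i. m k $ i \<le> 0"
  proof (intro eventually_all_finite)
    fix i
    have y_le: "y $ i - p $ i \<le> 0" if "i \<in> flat_actives x u"
      using that by (simp add: p_def pos_part_on_def)
    have "q x $ i \<le> 0" "q x $ i = 0 \<Longrightarrow> dq i x \<bullet> u \<le> 0"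
      using x(1) u[of i] by (auto simp: feasible_iff active_def)
    then have "i \<in> flat_actives x u \<or> q x $ i < 0 \<or> (q x $ i = 0 \<and> dq i x \<bullet> u < 0)"
      by (auto simp: flat_actives_def active_def)
    then consider "i \<in> flat_actives x u" | "q x $ i < 0" | "q x $ i = 0" "dq i x \<bullet> u < 0"
      by blast
    then show "\<forall>\<^sub>F k in sequentially. m k $ i \<le> 0"
    proof cases
      case 1
      then have "q x $ i = 0" "dq i x \<bullet> u = 0" by (auto simp: flat_actives_def active_def)
      then have "m k $ i \<le> 0" for k
        using y_le[OF 1] by (simp add: m_def mult_nonneg_nonpos)
      then show ?thesis by simp
    next
      case 2
      have "(\<lambda>k. m k $ i) \<longlonglongrightarrow> q x $ i + 0 * (dq i x \<bullet> u) + 0\<^sup>2 / 2 * (y $ i - p $ i)"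
        unfolding m_def vec_lambda_beta by (intro tendsto_intros t0) auto
      then have "\<forall>\<^sub>F k in sequentially. m k $ i < 0"
        using 2 by (intro order_tendstoD) auto
      then show ?thesis by (rule eventually_mono) simp
    next
      case 3
      have "(\<lambda>k. dq i x \<bullet> u + t0 k / 2 * (y $ i - p $ i)) \<longlonglongrightarrow> dq i x \<bullet> u + 0 / 2 * (y $ i - p $ i)"
        by (intro tendsto_intros t0) auto
      then have "\<forall>\<^sub>F k in sequentially. dq i x \<bullet> u + t0 k / 2 * (y $ i - p $ i) < 0"
        using 3 by (intro order_tendstoD) auto
      then show ?thesis
      proof (rule eventually_mono)
        fix k assume "dq i x \<bullet> u + t0 k / 2 * (y $ i - p $ i) < 0"
        then have "t0 k * (dq i x \<bullet> u + t0 k / 2 * (y $ i - p $ i)) \<le> 0"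
          using t0(1)[of k] by (simp add: mult_le_0_iff)
        moreover have "m k $ i = t0 k * (dq i x \<bullet> u + t0 k / 2 * (y $ i - p $ i))"
          using 3(1) by (simp add: m_def distrib_left power2_eq_square)
        ultimately show "m k $ i \<le> 0" by simp
      qed
    qed
  qed
  have inU: "\<forall>\<^sub>F k in sequentially. X k \<in> U"
    using topological_tendstoD[OF Xl open_U x(2)] .
  obtain K where K: "\<And>k. k \<ge> K \<Longrightarrow> X k \<in> U" "\<And>k i. k \<ge> K \<Longrightarrow> m k $ i \<le> 0"
    using eventually_conj[OF inU m_nonpos] unfolding eventually_sequentially by blast
  have "\<exists>w. w \<in> \<Gamma> \<and> norm (w - X k) \<le> c * ((t0 k)\<^sup>2 * norm (p /\<^sub>R 2 + e k))" if "k \<ge> K" for k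
  proof -
    have "\<Gamma> \<noteq> {}" using x(1) by blast
    then obtain w where w: "w \<in> \<Gamma>" "infdist (X k) \<Gamma> = dist (X k) w"
      using infdist_attains_inf[OF closed_feasible] by blast
    have "m k \<in> nonpos_orthant"
      using K(2)[OF that] by (simp add: nonpos_orthant_def)
    then have "infdist (q (X k)) nonpos_orthant \<le> dist (q (X k)) (m k)"
      by (rule infdist_le)
    also have "q (X k) - m k = (t0 k)\<^sup>2 *\<^sub>R (p /\<^sub>R 2 + e k)"
      using t0(1)[of k] by (simp add: vec_eq_iff m_def e_def field_simps)
    then have "dist (q (X k)) (m k) = (t0 k)\<^sup>2 * norm (p /\<^sub>R 2 + e k)"
      by (simp add: dist_norm)
    finally have near: "infdist (q (X k)) nonpos_orthant \<le> (t0 k)\<^sup>2 * norm (p /\<^sub>R 2 + e k)" .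
    have "dist (X k) w \<le> c * infdist (q (X k)) nonpos_orthant"
      using error_bound[OF K(1)[OF that]] w(2) by simp
    also have "\<dots> \<le> c * ((t0 k)\<^sup>2 * norm (p /\<^sub>R 2 + e k))"
      using near c_pos by (intro mult_left_mono) auto
    finally have "dist (X k) w \<le> c * ((t0 k)\<^sup>2 * norm (p /\<^sub>R 2 + e k))" .
    with w(1) show ?thesis
      by (auto simp: dist_norm norm_minus_commute)
  qed
  then obtain w where w: "\<And>k. k \<ge> K \<Longrightarrow> w k \<in> \<Gamma>"
    "\<And>k. k \<ge> K \<Longrightarrow> norm (w k - X k) \<le> c * ((t0 k)\<^sup>2 * norm (p /\<^sub>R 2 + e k))"
    by metis
  define \<zeta> where "\<zeta> k = (2 / (t0 (k + K))\<^sup>2) *\<^sub>R (w (k + K) - X (k + K))" for k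
  have w_eq: "w (k + K) = x + t0 (k + K) *\<^sub>R u + ((t0 (k + K))\<^sup>2 / 2) *\<^sub>R (z + \<zeta> k)" for k
    using t0(1)[of "k + K"]
    by (simp add: \<zeta>_def X_def h_def algebra_simps power2_eq_square)
  have \<zeta>_le: "norm (\<zeta> k) \<le> c * norm (p + 2 *\<^sub>R e (k + K))" for k
  proof -
    have "norm (\<zeta> k) = (2 / (t0 (k + K))\<^sup>2) * norm (w (k + K) - X (k + K))"
      by (simp add: \<zeta>_def)
    also have "\<dots> \<le> (2 / (t0 (k + K))\<^sup>2) * (c * ((t0 (k + K))\<^sup>2 * norm (p /\<^sub>R 2 + e (k + K))))"
      by (intro mult_left_mono w) auto
    also have "\<dots> = c * norm (2 *\<^sub>R (p /\<^sub>R 2 + e (k + K)))"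
      using t0(1)[of "k + K"] by (simp del: scaleR_add_right)
    finally show ?thesis by (simp add: scaleR_add_right)
  qed
  have lim: "(\<lambda>k. c * norm (p + 2 *\<^sub>R e (k + K))) \<longlonglongrightarrow> c * norm (p + 2 *\<^sub>R 0)"
    by (intro tendsto_intros LIMSEQ_ignore_initial_segment e0)
  then obtain B where "\<And>k. norm (c * norm (p + 2 *\<^sub>R e (k + K))) \<le> B"
    using convergent_imp_Bseq[OF convergentI[OF lim]] unfolding Bseq_def by blast
  with \<zeta>_le have "norm (\<zeta> k) \<le> B" for k
    by (metis abs_le_D1 order_trans real_norm_def)
  then obtain \<zeta>l \<sigma> where \<sigma>: "strict_mono \<sigma>" "(\<zeta> \<circ> \<sigma>) \<longlonglongrightarrow> \<zeta>l"
    using cball_cluster_point by metis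
  show ?thesis
  proof
    show "0 < t0 (\<sigma> k + K)" for k by (rule t0)
    show "(\<lambda>k. t0 (\<sigma> k + K)) \<longlonglongrightarrow> 0"
      using LIMSEQ_subseq_LIMSEQ[OF LIMSEQ_ignore_initial_segment[OF t0(2), of K] \<sigma>(1)] by (simp add: o_def)
    show "(\<lambda>k. z + \<zeta> (\<sigma> k)) \<longlonglongrightarrow> z + \<zeta>l"
      using \<sigma>(2) by (intro tendsto_intros) (simp add: o_def)
    show "x + t0 (\<sigma> k + K) *\<^sub>R u + ((t0 (\<sigma> k + K))\<^sup>2 / 2) *\<^sub>R (z + \<zeta> (\<sigma> k)) \<in> \<Gamma>" for k
      using w(1)[of "\<sigma> k + K"] w_eq[of "\<sigma> k"] by simp
    have "norm \<zeta>l \<le> c * norm p"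
    proof (rule LIMSEQ_le)
      show "(\<lambda>k. norm ((\<zeta> \<circ> \<sigma>) k)) \<longlonglongrightarrow> norm \<zeta>l"
        by (intro tendsto_intros \<sigma>)
      show "(\<lambda>k. c * norm (p + 2 *\<^sub>R e (\<sigma> k + K))) \<longlonglongrightarrow> c * norm p"
        using LIMSEQ_subseq_LIMSEQ[OF lim \<sigma>(1)] by (simp add: o_def)
    qed (use \<zeta>_le in auto)
    then show "norm (z + \<zeta>l - z) \<le> c * norm (pos_part_on (flat_actives x u) ((\<chi> i. dq i x \<bullet> z) + ineqs_curv x u))"
      by (simp add: p_def y_def)
  qed
qed

text \<open>A regular normal is nonpositive on tangents, and by \<open>feasible_arc\<close> each direction is within \<open>c\<close>
  times its linearized violation of a tangent.\<close>

lemma regular_normal_bounded_multiplier: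
  assumes x: "x \<in> \<Gamma>" "x \<in> U" and xs: "xs \<in> regular_normal_cone \<Gamma> x"
  obtains l where "l \<in> multipliers q x xs" "norm l \<le> c * norm xs"
proof -
  have J: "flat_actives x 0 = active q x"
    by (simp add: flat_actives_def)
  have b0: "ineqs_curv x 0 = 0"
    by (simp add: ineqs_curv_def qcurv_def vec_eq_iff)
  have "xs \<bullet> z \<le> 0 + (c * norm xs) * norm (pos_part_on (active q x) ((\<chi> i. dq i x \<bullet> z) + 0))" for z
  proof -
    obtain t z' zl where tz: "\<And>k. 0 < t k" "t \<longlonglongrightarrow> 0" "z' \<longlonglongrightarrow> zl"
      "\<And>k::nat. x + t k *\<^sub>R 0 + ((t k)\<^sup>2 / 2) *\<^sub>R z' k \<in> \<Gamma>"
      "norm (zl - z) \<le> c * norm (pos_part_on (active q x) ((\<chi> i. dq i x \<bullet> z) + 0))"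
      using feasible_arc[OF x, of 0 z] unfolding J b0 by auto
    have "(\<lambda>k. (t k)\<^sup>2 / 2) \<longlonglongrightarrow> 0\<^sup>2 / 2"
      by (intro tendsto_intros tz) auto
    then have "zl \<in> tangent_cone \<Gamma> x"
      unfolding tangent_cone_def mem_Collect_eq using tz
      by (intro exI[of _ "\<lambda>k. (t k)\<^sup>2 / 2"] exI[of _ z']) (auto simp: less_imp_neq[symmetric])
    then have "xs \<bullet> zl \<le> 0"
      using xs by (simp add: regular_normal_cone_def)
    then have "xs \<bullet> z \<le> xs \<bullet> (z - zl)"
      by (simp add: inner_diff_right)
    also have "\<dots> \<le> norm xs * norm (zl - z)"
      using norm_cauchy_schwarz[of xs "z - zl"] by (simp add: norm_minus_commute)
    also have "\<dots> \<le> norm xs * (c * norm (pos_part_on (active q x) ((\<chi> i. dq i x \<bullet> z) + 0)))"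
      by (intro mult_left_mono tz) auto
    finally show ?thesis by (simp add: algebra_simps)
  qed
  from bounded_multiplier_alternative[OF _ this] c_pos that show ?thesis
    by (simp add: multipliers_iff) blast
qed

text \<open>The bound on the multipliers provides compactness, and complementarity survives the limit as the
  equation \<open>l $ i * q x $ i = 0\<close>.\<close>

lemma multiplier_limit:
  assumes y: "y \<longlonglongrightarrow> x" "x \<in> \<Gamma>" and w: "w \<longlonglongrightarrow> xs"
    and l: "\<And>k. l k \<in> multipliers q (y k) (w k)" "\<And>k. norm (l k) \<le> c * norm (w k)"
  obtains \<sigma> ll where "strict_mono \<sigma>" "(l \<circ> \<sigma>) \<longlonglongrightarrow> ll" "ll \<in> multipliers q x xs" "norm ll \<le> c * norm xs"
proof -
  have lim: "(\<lambda>k. c * norm (w k)) \<longlonglongrightarrow> c * norm xs"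
    by (intro tendsto_intros w)
  then obtain B where "\<And>k. norm (c * norm (w k)) \<le> B"
    using convergent_imp_Bseq[OF convergentI[OF lim]] unfolding Bseq_def by blast
  with l(2) have "norm (l k) \<le> B" for k
    by (metis abs_le_D1 order_trans real_norm_def)
  then obtain ll \<sigma> where \<sigma>: "strict_mono \<sigma>" "(l \<circ> \<sigma>) \<longlonglongrightarrow> ll"
    using cball_cluster_point by metis
  have comp: "(\<lambda>k. l (\<sigma> k) $ i) \<longlonglongrightarrow> ll $ i" for i
    using tendsto_vec_nth[OF \<sigma>(2)] by (simp add: o_def)
  have y\<sigma>: "(\<lambda>k. y (\<sigma> k)) \<longlonglongrightarrow> x" and w\<sigma>: "(\<lambda>k. w (\<sigma> k)) \<longlonglongrightarrow> xs"
    using LIMSEQ_subseq_LIMSEQ[OF y(1) \<sigma>(1)] LIMSEQ_subseq_LIMSEQ[OF w \<sigma>(1)] by (simp_all add: o_def)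
  have "0 \<le> ll $ i" for i
    by (rule LIMSEQ_le_const[OF comp]) (use l(1) in \<open>auto simp: multipliers_iff\<close>)
  moreover have "ll $ i = 0" if "i \<notin> active q x" for i
  proof -
    have "(\<lambda>k. l (\<sigma> k) $ i * q (y (\<sigma> k)) $ i) \<longlonglongrightarrow> ll $ i * q x $ i"
      by (intro tendsto_intros comp q_tendsto y\<sigma>)
    moreover have "l (\<sigma> k) $ i * q (y (\<sigma> k)) $ i = 0" for k
      using l(1)[of "\<sigma> k"] by (auto simp: multipliers_iff active_def)
    ultimately have "ll $ i * q x $ i = 0"
      by (simp add: LIMSEQ_const_iff)
    with that show ?thesis by (simp add: active_def)
  qed
  moreover have "(\<Sum>i\<in>UNIV. ll $ i *\<^sub>R dq i x) = xs"
  proof -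
    have "(\<lambda>k. \<Sum>i\<in>UNIV. l (\<sigma> k) $ i *\<^sub>R dq i (y (\<sigma> k))) \<longlonglongrightarrow> (\<Sum>i\<in>UNIV. ll $ i *\<^sub>R dq i x)"
      by (intro tendsto_intros comp dq_tendsto y\<sigma>)
    moreover have "(\<Sum>i\<in>UNIV. l (\<sigma> k) $ i *\<^sub>R dq i (y (\<sigma> k))) = w (\<sigma> k)" for k
      using l(1)[of "\<sigma> k"] by (simp add: multipliers_iff)
    ultimately show ?thesis
      using w\<sigma> LIMSEQ_unique by simp
  qed
  moreover have "norm ll \<le> c * norm xs"
  proof (rule LIMSEQ_le)
    show "(\<lambda>k. norm ((l \<circ> \<sigma>) k)) \<longlonglongrightarrow> norm ll"
      by (intro tendsto_intros \<sigma>)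
    show "(\<lambda>k. c * norm (w (\<sigma> k))) \<longlonglongrightarrow> c * norm xs"
      by (intro tendsto_intros w\<sigma>)
  qed (use l(2) in auto)
  ultimately show ?thesis
    using that \<sigma> by (simp add: multipliers_iff)
qed

lemma limiting_normal_bounded_multiplier:
  assumes x: "x \<in> U" and xs: "xs \<in> limiting_normal_cone \<Gamma> x"
  obtains l where "l \<in> multipliers q x xs" "norm l \<le> c * norm xs"
proof -
  have xG: "x \<in> \<Gamma>" using xs by (auto simp: limiting_normal_cone_def split: if_splits)
  then obtain y w where yw: "y \<longlonglongrightarrow> x" "\<And>k. y k \<in> \<Gamma>" "\<And>k. w k \<in> regular_normal_cone \<Gamma> (y k)" "w \<longlonglongrightarrow> xs"
    using xs by (auto simp: limiting_normal_cone_def)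
  obtain K where K: "\<And>k. k \<ge> K \<Longrightarrow> y k \<in> U"
    using topological_tendstoD[OF yw(1) open_U x] unfolding eventually_sequentially by blast
  have "\<exists>l. l \<in> multipliers q (y (k + K)) (w (k + K)) \<and> norm l \<le> c * norm (w (k + K))" for k
    using regular_normal_bounded_multiplier[OF yw(2) K yw(3), of "k + K"] by auto
  then obtain l where l: "\<And>k. l k \<in> multipliers q (y (k + K)) (w (k + K))"
      "\<And>k. norm (l k) \<le> c * norm (w (k + K))"
    by metis
  show ?thesis
    using multiplier_limit[OF LIMSEQ_ignore_initial_segment[OF yw(1)] xG
        LIMSEQ_ignore_initial_segment[OF yw(4)] l] that by metis
qed

end

section \<open>Second-order conditions and tangents to the graph of the normal cone\<close>

lemma regular_normal_imp_limiting:
  assumes "x \<in> S" "v \<in> regular_normal_cone S x"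
  shows "v \<in> limiting_normal_cone S x"
proof -
  have "\<exists>y u. y \<longlonglongrightarrow> x \<and> (\<forall>k::nat. y k \<in> S) \<and> (\<forall>k. u k \<in> regular_normal_cone S (y k)) \<and> u \<longlonglongrightarrow> v"
    using assms by (intro exI[of _ "\<lambda>_. x"] exI[of _ "\<lambda>_. v"]) simp
  with assms(1) show ?thesis
    by (simp add: limiting_normal_cone_def)
qed

lemma local_minimizer_imp_normal:
  assumes y: "y \<in> S" and D: "(h has_derivative (\<lambda>w. d \<bullet> w)) (at y)"
    and "\<epsilon> > 0" and min: "\<And>y'. y' \<in> S \<Longrightarrow> dist y' y < \<epsilon> \<Longrightarrow> h y \<le> h y'"
  shows "- d \<in> limiting_normal_cone S y"
proof (rule regular_normal_imp_limiting[OF y])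
  show "- d \<in> regular_normal_cone S y"
    unfolding regular_normal_cone_def
  proof (safe)
    fix w assume "w \<in> tangent_cone S y"
    then obtain t u where tu: "\<And>k::nat. 0 < t k" "t \<longlonglongrightarrow> (0::real)" "u \<longlonglongrightarrow> w" "\<And>k. y + t k *\<^sub>R u k \<in> S"
      unfolding tangent_cone_def by auto
    have "(\<lambda>k. y + t k *\<^sub>R u k) \<longlonglongrightarrow> y + 0 *\<^sub>R w"
      by (intro tendsto_intros tu)
    then have "\<forall>\<^sub>F k in sequentially. dist (y + t k *\<^sub>R u k) y < \<epsilon>"
      using tendstoD[OF _ \<open>\<epsilon> > 0\<close>] by fastforce
    then have "\<forall>\<^sub>F k in sequentially. 0 \<le> (h (y + t k *\<^sub>R u k) - h y) /\<^sub>R t k"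
      by eventually_elim (use min tu in \<open>auto simp: less_imp_le\<close>)
    then have "0 \<le> d \<bullet> w"
      using difference_quotient_tendsto[OF D tu(1-3)] tendsto_lowerbound trivial_limit_sequentially by blast
    then show "- d \<bullet> w \<le> 0" by simp
  qed
qed

context smooth_program
begin

lemma multiplier_inner:
  assumes "l \<in> multipliers q x xs"
  shows "xs \<bullet> w = (\<Sum>i\<in>UNIV. l $ i * (dq i x \<bullet> w))"
  using assms by (auto simp: multipliers_iff inner_sum_left)

lemma multiplier_complementary:
  assumes "l \<in> multipliers q x xs"
  shows "l $ i * q x $ i = 0"
  using assms by (auto simp: multipliers_iff active_def)

lemma multiplier_imp_regular_normal:
  assumes x: "x \<in> \<Gamma>" and l: "l \<in> multipliers q x xs"
  shows "xs \<in> regular_normal_cone \<Gamma> x"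
  unfolding regular_normal_cone_def
proof safe
  fix w assume "w \<in> tangent_cone \<Gamma> x"
  then obtain t u where tu: "\<And>k::nat. 0 < t k" "t \<longlonglongrightarrow> (0::real)" "u \<longlonglongrightarrow> w" "\<And>k. x + t k *\<^sub>R u k \<in> \<Gamma>"
    unfolding tangent_cone_def by auto
  have "dq i x \<bullet> w \<le> 0" if "i \<in> active q x" for i
  proof (rule LIMSEQ_le_const2)
    show "(\<lambda>k. (q (x + t k *\<^sub>R u k) $ i - q x $ i) /\<^sub>R t k) \<longlonglongrightarrow> dq i x \<bullet> w"
      unfolding dq_def by (rule difference_quotient_tendsto[OF C2_has_derivative[OF C2_q] tu(1-3)])
    show "\<exists>N. \<forall>k\<ge>N. (q (x + t k *\<^sub>R u k) $ i - q x $ i) /\<^sub>R t k \<le> 0"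
      using tu that by (auto simp: feasible_iff active_def mult_le_0_iff less_imp_le)
  qed
  then have "l $ i * (dq i x \<bullet> w) \<le> 0" for i
    using l by (cases "i \<in> active q x") (auto simp: multipliers_iff mult_nonneg_nonpos)
  then have "(\<Sum>i\<in>UNIV. l $ i * (dq i x \<bullet> w)) \<le> 0"
    by (intro sum_nonpos) simp
  then show "xs \<bullet> w \<le> 0"
    by (simp add: multiplier_inner[OF l])
qed

end

context subregular_program
begin

text \<open>Along the arc \<open>x + t u + (t\<^sup>2 / 2) z'\<close> the first-order terms cancel because \<open>u\<close> is a critical direction,
  and the growth inequality becomes, at order \<open>t\<^sup>2\<close>, an upper bound for \<open>xs \<bullet> z'\<close>.
  It extends to all \<open>z\<close> with a penalty on their violation, and
  \<open>bounded_multiplier_alternative\<close> turns it into a multiplier.\<close>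

lemma second_order_necessary_condition:
  assumes x: "x \<in> \<Gamma>" "x \<in> U"
    and l0: "l0 \<in> multipliers q x (v - grad g x)"
    and u: "\<And>i. i \<in> active q x \<Longrightarrow> dq i x \<bullet> u \<le> 0" "\<And>i. 0 < l0 $ i \<Longrightarrow> dq i x \<bullet> u = 0"
    and "\<epsilon> > 0"
    and growth: "\<And>y. y \<in> \<Gamma> \<Longrightarrow> dist y x < \<epsilon> \<Longrightarrow> g x + v \<bullet> (y - x) + m * (norm (y - x))\<^sup>2 / 2 \<le> g y"
  obtains l where "l \<in> multipliers q x (v - grad g x)"
    "m * (norm u)\<^sup>2 \<le> gcurv x u + (\<Sum>i\<in>UNIV. l $ i * qcurv i x u)"
proof -
  define xs where "xs = v - grad g x"
  define \<beta> where "\<beta> = gcurv x u - m * (norm u)\<^sup>2"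
  have l0_zero: "l0 $ i * (dq i x \<bullet> u) = 0" for i
    using u(2)[of i] l0 by (cases "l0 $ i = 0") (auto simp: multipliers_iff less_le)
  have xsu: "xs \<bullet> u = 0"
    unfolding xs_def multiplier_inner[OF l0] l0_zero by simp
  have "xs \<bullet> z \<le> \<beta> + (c * norm xs) * norm (pos_part_on (flat_actives x u) ((\<chi> i. dq i x \<bullet> z) + ineqs_curv x u))" for z
  proof -
    obtain t z' zl where tz: "\<And>k. 0 < t k" "t \<longlonglongrightarrow> 0" "z' \<longlonglongrightarrow> zl"
      "\<And>k::nat. x + t k *\<^sub>R u + ((t k)\<^sup>2 / 2) *\<^sub>R z' k \<in> \<Gamma>"
      "norm (zl - z) \<le> c * norm (pos_part_on (flat_actives x u) ((\<chi> i. dq i x \<bullet> z) + ineqs_curv x u))"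
      using feasible_arc[OF x u(1)] by blast
    define h where "h k = u + (t k / 2) *\<^sub>R z' k" for k
    have "h \<longlonglongrightarrow> u + (0 / 2) *\<^sub>R zl"
      unfolding h_def[abs_def] by (intro tendsto_intros tz) auto
    then have hl: "h \<longlonglongrightarrow> u" by simp
    have feas: "x + t k *\<^sub>R h k \<in> \<Gamma>" for k
      using tz(4)[of k] by (simp add: h_def algebra_simps power2_eq_square)
    have "(\<lambda>k. x + t k *\<^sub>R h k) \<longlonglongrightarrow> x + 0 *\<^sub>R u"
      by (intro tendsto_intros tz hl)
    then have "\<forall>\<^sub>F k in sequentially. dist (x + t k *\<^sub>R h k) x < \<epsilon>"
      using tendstoD[OF _ \<open>\<epsilon> > 0\<close>] by fastforce
    then have ev: "\<forall>\<^sub>F k in sequentially. m * (norm (h k))\<^sup>2 / 2 + xs \<bullet> z' k / 2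
        \<le> (g (x + t k *\<^sub>R h k) - g x - t k * (grad g x \<bullet> h k)) / (t k)\<^sup>2"
    proof eventually_elim
      case (elim k)
      have "v \<bullet> (t k *\<^sub>R h k) = t k * (grad g x \<bullet> h k) + (t k)\<^sup>2 * (xs \<bullet> z' k / 2)"
      proof -
        have "v \<bullet> h k = grad g x \<bullet> h k + xs \<bullet> h k"
          by (simp add: xs_def inner_diff_left)
        also have "xs \<bullet> h k = t k * (xs \<bullet> z' k / 2)"
          by (simp add: h_def inner_add_right xsu)
        finally show ?thesis by (simp add: algebra_simps power2_eq_square)
      qed
      moreover have "(norm (t k *\<^sub>R h k))\<^sup>2 = (t k)\<^sup>2 * (norm (h k))\<^sup>2"
        by (simp add: power_mult_distrib)
      ultimately have "(m * (norm (h k))\<^sup>2 / 2 + xs \<bullet> z' k / 2) * (t k)\<^sup>2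
          \<le> g (x + t k *\<^sub>R h k) - g x - t k * (grad g x \<bullet> h k)"
        using growth[OF feas elim] by (simp add: algebra_simps)
      then show ?case
        using tz(1)[of k] by (simp add: pos_le_divide_eq)
    qed
    have lim1: "(\<lambda>k. (g (x + t k *\<^sub>R h k) - g x - t k * (grad g x \<bullet> h k)) / (t k)\<^sup>2) \<longlonglongrightarrow> gcurv x u / 2"
      unfolding gcurv_def by (rule second_order_quotient_tendsto[OF C2_g tz(1,2) hl])
    have lim2: "(\<lambda>k. m * (norm (h k))\<^sup>2 / 2 + xs \<bullet> z' k / 2) \<longlonglongrightarrow> m * (norm u)\<^sup>2 / 2 + xs \<bullet> zl / 2"
      by (intro tendsto_intros hl tz) auto
    have "m * (norm u)\<^sup>2 / 2 + xs \<bullet> zl / 2 \<le> gcurv x u / 2"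
      by (rule tendsto_le[OF trivial_limit_sequentially lim1 lim2 ev])
    then have "xs \<bullet> zl \<le> \<beta>" by (simp add: \<beta>_def)
    moreover have "xs \<bullet> (z - zl) \<le> norm xs * norm (zl - z)"
      using norm_cauchy_schwarz[of xs "z - zl"] by (simp add: norm_minus_commute)
    moreover have "norm xs * norm (zl - z) \<le> norm xs * (c * norm (pos_part_on (flat_actives x u) ((\<chi> i. dq i x \<bullet> z) + ineqs_curv x u)))"
      by (intro mult_left_mono tz) auto
    ultimately show ?thesis by (simp add: inner_diff_right algebra_simps)
  qed
  note bound = this
  have "0 \<le> c * norm xs" using c_pos by simp
  then obtain l where l: "\<And>i. 0 \<le> l $ i" "\<And>i. i \<notin> flat_actives x u \<Longrightarrow> l $ i = 0"
    "(\<Sum>i\<in>UNIV. l $ i *\<^sub>R dq i x) = xs" "- \<beta> \<le> l \<bullet> ineqs_curv x u"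
    by (rule bounded_multiplier_alternative[OF _ bound]) blast
  show ?thesis
  proof
    show "l \<in> multipliers q x (v - grad g x)"
      using l by (auto simp: multipliers_iff flat_actives_def xs_def)
    show "m * (norm u)\<^sup>2 \<le> gcurv x u + (\<Sum>i\<in>UNIV. l $ i * qcurv i x u)"
      using l(4) by (simp add: \<beta>_def ineqs_curv_def inner_vec_def)
  qed
qed

text \<open>Let \<open>\<mu> k\<close> be bounded multipliers at the points \<open>X k\<close>, converging to \<open>l\<close>. An index with \<open>l $ i > 0\<close>
  is active at \<open>X k\<close> for large \<open>k\<close>, so \<open>\<Sum>i. l $ i * q (X k) $ i = 0\<close>, whereas this sum is nonpositive for any
  other multiplier \<open>l'\<close>. As \<open>l\<close> and \<open>l'\<close> represent the same normal, zeroth and first-order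
  terms cancel in the difference, and the second-order term shows that \<open>l\<close> maximizes the
  curvature. Expanding \<open>\<Sum>i. (\<mu> k $ i - l $ i) * q (X k) $ i\<close>, which vanishes for large \<open>k\<close>, in the same way yields the
  formula for \<open>wl \<bullet> ul\<close>.\<close>

lemma normal_cone_graphical_derivative:
  assumes x: "x \<in> \<Gamma>" and t: "\<And>k. 0 < t k" "t \<longlonglongrightarrow> 0"
    and u: "u \<longlonglongrightarrow> ul" and w: "w \<longlonglongrightarrow> wl"
    and xk: "\<And>k. x + t k *\<^sub>R u k \<in> U"
    and nk: "\<And>k. xs + t k *\<^sub>R w k \<in> limiting_normal_cone \<Gamma> (x + t k *\<^sub>R u k)"
  obtains l where "l \<in> multipliers q x xs" "norm l \<le> c * norm xs"
    "\<And>l'. l' \<in> multipliers q x xs \<Longrightarrow> (\<Sum>i\<in>UNIV. l' $ i * qcurv i x ul) \<le> (\<Sum>i\<in>UNIV. l $ i * qcurv i x ul)"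
    "\<And>i. i \<in> active q x \<Longrightarrow> dq i x \<bullet> ul \<le> 0" "\<And>i. 0 < l $ i \<Longrightarrow> dq i x \<bullet> ul = 0"
    "wl \<bullet> ul = (\<Sum>i\<in>UNIV. l $ i * qcurv i x ul)"
proof -
  have feas0: "x + t k *\<^sub>R u k \<in> \<Gamma>" for k
    using nk[of k] by (auto simp: limiting_normal_cone_def split: if_splits)
  have "\<exists>l. l \<in> multipliers q (x + t k *\<^sub>R u k) (xs + t k *\<^sub>R w k) \<and> norm l \<le> c * norm (xs + t k *\<^sub>R w k)" for k
    using limiting_normal_bounded_multiplier[OF xk nk] by metis
  then obtain lk where lk: "\<And>k. lk k \<in> multipliers q (x + t k *\<^sub>R u k) (xs + t k *\<^sub>R w k)"
    "\<And>k. norm (lk k) \<le> c * norm (xs + t k *\<^sub>R w k)" by metis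
  have "(\<lambda>k. x + t k *\<^sub>R u k) \<longlonglongrightarrow> x + 0 *\<^sub>R ul" "(\<lambda>k. xs + t k *\<^sub>R w k) \<longlonglongrightarrow> xs + 0 *\<^sub>R wl"
    by (intro tendsto_intros t u w)+
  then have lims0: "(\<lambda>k. x + t k *\<^sub>R u k) \<longlonglongrightarrow> x" "(\<lambda>k. xs + t k *\<^sub>R w k) \<longlonglongrightarrow> xs"
    by simp_all
  obtain \<sigma> l where \<sigma>: "strict_mono \<sigma>" "(lk \<circ> \<sigma>) \<longlonglongrightarrow> l" and l: "l \<in> multipliers q x xs" "norm l \<le> c * norm xs"
    using multiplier_limit[OF lims0(1) x lims0(2) lk] by blast
  define \<tau> \<mu> h \<omega> X where "\<tau> k = t (\<sigma> k)" and "\<mu> k = lk (\<sigma> k)" and "h k = u (\<sigma> k)" and "\<omega> k = w (\<sigma> k)"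
    and "X k = x + t (\<sigma> k) *\<^sub>R u (\<sigma> k)" for k
  have \<tau>: "\<And>k. 0 < \<tau> k" "\<tau> \<longlonglongrightarrow> 0" and hl: "h \<longlonglongrightarrow> ul" and \<omega>l: "\<omega> \<longlonglongrightarrow> wl" and Xl: "X \<longlonglongrightarrow> x"
    using t(1) LIMSEQ_subseq_LIMSEQ[OF t(2) \<sigma>(1)] LIMSEQ_subseq_LIMSEQ[OF u \<sigma>(1)]
      LIMSEQ_subseq_LIMSEQ[OF w \<sigma>(1)] LIMSEQ_subseq_LIMSEQ[OF lims0(1) \<sigma>(1)]
    by (simp_all add: \<tau>_def[abs_def] h_def[abs_def] \<omega>_def[abs_def] X_def[abs_def] o_def)
  have X_eq: "X k = x + \<tau> k *\<^sub>R h k" for k by (simp add: X_def \<tau>_def h_def)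
  have \<mu>: "\<mu> k \<in> multipliers q (X k) (xs + \<tau> k *\<^sub>R \<omega> k)" for k
    using lk(1)[of "\<sigma> k"] by (simp add: \<mu>_def X_def \<tau>_def \<omega>_def)
  have \<mu>l: "(\<lambda>k. \<mu> k $ i) \<longlonglongrightarrow> l $ i" for i
    using tendsto_vec_nth[OF \<sigma>(2)] by (simp add: o_def \<mu>_def)
  have Xfeas: "q (X k) $ i \<le> 0" for k i
    using feas0[of "\<sigma> k"] by (simp add: X_def feasible_iff)
  have qX: "(\<lambda>k. q (X k) $ i) \<longlonglongrightarrow> q x $ i" for i
    by (rule q_tendsto[OF Xl])
  have evpos: "\<forall>\<^sub>F k in sequentially. l $ i * q (X k) $ i = 0" for i
  proof (cases "0 < l $ i")
    case True
    have "\<forall>\<^sub>F k in sequentially. 0 < \<mu> k $ i"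
      using order_tendstoD(1)[OF \<mu>l True] .
    then show ?thesis
      by eventually_elim (use multiplier_complementary[OF \<mu>] in force)
  next
    case False
    then have "l $ i = 0" using l(1) by (auto simp: multipliers_iff less_le)
    then show ?thesis by simp
  qed
  have evinact: "\<forall>\<^sub>F k in sequentially. \<mu> k $ i * q x $ i = 0" for i
  proof (cases "q x $ i = 0")
    case False
    then have "q x $ i < 0" using x by (auto simp: feasible_iff less_le)
    from order_tendstoD(2)[OF qX this] show ?thesis
      by eventually_elim (use multiplier_complementary[OF \<mu>] in force)
  qed simp
  have ev: "\<forall>\<^sub>F k in sequentially. \<forall>i. l $ i * q (X k) $ i = 0 \<and> \<mu> k $ i * q x $ i = 0"
    using eventually_conj[OF evpos evinact] by (intro eventually_all_finite) simp
  define E where "E i k = (q (X k) $ i - q x $ i - \<tau> k * (dq i x \<bullet> h k)) / (\<tau> k)\<^sup>2" for i k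
  have El: "E i \<longlonglongrightarrow> qcurv i x ul / 2" for i
    unfolding E_def[abs_def] X_eq qcurv_def dq_def by (rule second_order_quotient_tendsto[OF C2_q \<tau> hl])
  have E_eq: "E i k * (\<tau> k)\<^sup>2 = q (X k) $ i - q x $ i - \<tau> k * (dq i x \<bullet> h k)" for i k
    using \<tau>(1)[of k] by (simp add: E_def)
  have dir: "(\<lambda>k. (q (X k) $ i - q x $ i) /\<^sub>R \<tau> k) \<longlonglongrightarrow> dq i x \<bullet> ul" for i
    unfolding X_eq dq_def by (rule difference_quotient_tendsto[OF C2_has_derivative[OF C2_q] \<tau> hl])
  show ?thesis
  proof
    show "l \<in> multipliers q x xs" "norm l \<le> c * norm xs" by fact+
    show "dq i x \<bullet> ul \<le> 0" if "i \<in> active q x" for i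
      by (rule LIMSEQ_le_const2[OF dir])
         (use that Xfeas \<tau>(1) in \<open>auto simp: active_def mult_le_0_iff less_imp_le\<close>)
    show "dq i x \<bullet> ul = 0" if "0 < l $ i" for i
    proof -
      have "q x $ i = 0" using multiplier_complementary[OF l(1), of i] that by simp
      have "\<forall>\<^sub>F k in sequentially. (q (X k) $ i - q x $ i) /\<^sub>R \<tau> k = 0"
        using evpos[of i] by eventually_elim (use that \<open>q x $ i = 0\<close> in auto)
      from LIMSEQ_unique[OF dir tendsto_eventually[OF this]] show ?thesis .
    qed
  next
    fix l' assume l': "l' \<in> multipliers q x xs"
    have "\<forall>\<^sub>F k in sequentially. 0 \<le> (\<Sum>i\<in>UNIV. (l $ i - l' $ i) * E i k)"
      using ev
    proof eventually_elim
      case (elim k)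
      have "(\<Sum>i\<in>UNIV. (l $ i - l' $ i) * E i k) * (\<tau> k)\<^sup>2 = (\<Sum>i\<in>UNIV. (l $ i - l' $ i) * (E i k * (\<tau> k)\<^sup>2))"
        by (simp add: sum_distrib_right mult.assoc)
      also have "\<dots> = (\<Sum>i\<in>UNIV. - (l' $ i * q (X k) $ i) - \<tau> k * (l $ i * (dq i x \<bullet> h k)) + \<tau> k * (l' $ i * (dq i x \<bullet> h k)))"
      proof (intro sum.cong refl)
        fix i
        have "(l $ i - l' $ i) * (E i k * (\<tau> k)\<^sup>2) = l $ i * q (X k) $ i - l' $ i * q (X k) $ i - l $ i * q x $ i + l' $ i * q x $ i
            - \<tau> k * (l $ i * (dq i x \<bullet> h k)) + \<tau> k * (l' $ i * (dq i x \<bullet> h k))"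
          unfolding E_eq by (simp add: algebra_simps)
        then show "(l $ i - l' $ i) * (E i k * (\<tau> k)\<^sup>2)
            = - (l' $ i * q (X k) $ i) - \<tau> k * (l $ i * (dq i x \<bullet> h k)) + \<tau> k * (l' $ i * (dq i x \<bullet> h k))"
          using elim multiplier_complementary[OF l(1), of i] multiplier_complementary[OF l', of i] by simp
      qed
      also have "\<dots> = (\<Sum>i\<in>UNIV. - (l' $ i * q (X k) $ i))"
        using multiplier_inner[OF l(1), of "h k"] multiplier_inner[OF l', of "h k"]
        by (simp add: sum.distrib sum_subtractf sum_distrib_left[symmetric])
      also have "\<dots> \<ge> 0"
        using l' Xfeas by (intro sum_nonneg) (auto simp: multipliers_iff mult_le_0_iff)
      finally show ?case
        using \<tau>(1)[of k] by (simp add: zero_le_mult_iff)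
    qed
    moreover have "(\<lambda>k. \<Sum>i\<in>UNIV. (l $ i - l' $ i) * E i k) \<longlonglongrightarrow> (\<Sum>i\<in>UNIV. (l $ i - l' $ i) * (qcurv i x ul / 2))"
      by (intro tendsto_intros El)
    ultimately have "0 \<le> (\<Sum>i\<in>UNIV. (l $ i - l' $ i) * (qcurv i x ul / 2))"
      using tendsto_lowerbound trivial_limit_sequentially by blast
    also have "\<dots> = ((\<Sum>i\<in>UNIV. l $ i * qcurv i x ul) - (\<Sum>i\<in>UNIV. l' $ i * qcurv i x ul)) / 2"
      by (simp add: sum_subtractf[symmetric] sum_divide_distrib left_diff_distrib)
    finally show "(\<Sum>i\<in>UNIV. l' $ i * qcurv i x ul) \<le> (\<Sum>i\<in>UNIV. l $ i * qcurv i x ul)"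
      by simp
  next
    define D where "D i k = (dq i (X k) - dq i x) /\<^sub>R \<tau> k" for i k
    have Dl: "D i \<longlonglongrightarrow> hess (\<lambda>y. q y $ i) x *v ul" for i
      unfolding D_def[abs_def] X_eq dq_def
      by (rule difference_quotient_tendsto[OF C2_grad_has_derivative[OF C2_q] \<tau> hl])
    have D_eq: "\<tau> k *\<^sub>R D i k = dq i (X k) - dq i x" for i k
      using \<tau>(1)[of k] by (simp add: D_def)
    have "\<forall>\<^sub>F k in sequentially. (\<Sum>i\<in>UNIV. (\<mu> k $ i - l $ i) * E i k) = - (\<omega> k \<bullet> h k) + (\<Sum>i\<in>UNIV. \<mu> k $ i * (D i k \<bullet> h k))"
      using ev
    proof eventually_elim
      case (elim k)
      have "(\<Sum>i\<in>UNIV. \<mu> k $ i * (dq i x \<bullet> h k)) + \<tau> k * (\<Sum>i\<in>UNIV. \<mu> k $ i * (D i k \<bullet> h k))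
          = (\<Sum>i\<in>UNIV. \<mu> k $ i * ((dq i x + \<tau> k *\<^sub>R D i k) \<bullet> h k))"
        by (simp add: sum_distrib_left sum.distrib inner_add_left algebra_simps)
      also have "\<dots> = (\<Sum>i\<in>UNIV. \<mu> k $ i * (dq i (X k) \<bullet> h k))"
        by (simp add: D_eq)
      also have "\<dots> = xs \<bullet> h k + \<tau> k * (\<omega> k \<bullet> h k)"
        using multiplier_inner[OF \<mu>, of k "h k"] by (simp add: inner_add_left)
      finally have A: "(\<Sum>i\<in>UNIV. \<mu> k $ i * (dq i x \<bullet> h k))
          = xs \<bullet> h k + \<tau> k * (\<omega> k \<bullet> h k) - \<tau> k * (\<Sum>i\<in>UNIV. \<mu> k $ i * (D i k \<bullet> h k))"
        by simp
      have "(\<Sum>i\<in>UNIV. (\<mu> k $ i - l $ i) * E i k) * (\<tau> k)\<^sup>2 = (\<Sum>i\<in>UNIV. (\<mu> k $ i - l $ i) * (E i k * (\<tau> k)\<^sup>2))"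
        by (simp add: sum_distrib_right mult.assoc)
      also have "\<dots> = (\<Sum>i\<in>UNIV. \<tau> k * (l $ i * (dq i x \<bullet> h k)) - \<tau> k * (\<mu> k $ i * (dq i x \<bullet> h k)))"
      proof (intro sum.cong refl)
        fix i
        have "(\<mu> k $ i - l $ i) * (E i k * (\<tau> k)\<^sup>2) = \<mu> k $ i * q (X k) $ i - l $ i * q (X k) $ i - \<mu> k $ i * q x $ i + l $ i * q x $ i
            + \<tau> k * (l $ i * (dq i x \<bullet> h k)) - \<tau> k * (\<mu> k $ i * (dq i x \<bullet> h k))"
          unfolding E_eq by (simp add: algebra_simps)
        then show "(\<mu> k $ i - l $ i) * (E i k * (\<tau> k)\<^sup>2)
            = \<tau> k * (l $ i * (dq i x \<bullet> h k)) - \<tau> k * (\<mu> k $ i * (dq i x \<bullet> h k))"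
          using elim multiplier_complementary[OF l(1), of i] multiplier_complementary[OF \<mu>, of k i] by simp
      qed
      also have "\<dots> = \<tau> k * (xs \<bullet> h k) - \<tau> k * (\<Sum>i\<in>UNIV. \<mu> k $ i * (dq i x \<bullet> h k))"
        using multiplier_inner[OF l(1), of "h k"] by (simp add: sum_subtractf sum_distrib_left[symmetric])
      also have "\<dots> = (- (\<omega> k \<bullet> h k) + (\<Sum>i\<in>UNIV. \<mu> k $ i * (D i k \<bullet> h k))) * (\<tau> k)\<^sup>2"
        unfolding A by (simp add: algebra_simps power2_eq_square)
      finally show ?case
        using \<tau>(1)[of k] by simp
    qed
    moreover have "(\<lambda>k. \<Sum>i\<in>UNIV. (\<mu> k $ i - l $ i) * E i k) \<longlonglongrightarrow> (\<Sum>i\<in>UNIV. (l $ i - l $ i) * (qcurv i x ul / 2))"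
      by (intro tendsto_intros \<mu>l El)
    ultimately have "(\<lambda>k. - (\<omega> k \<bullet> h k) + (\<Sum>i\<in>UNIV. \<mu> k $ i * (D i k \<bullet> h k))) \<longlonglongrightarrow> (\<Sum>i\<in>UNIV. (l $ i - l $ i) * (qcurv i x ul / 2))"
      by (rule Lim_transform_eventually[rotated])
    moreover have "(\<lambda>k. - (\<omega> k \<bullet> h k) + (\<Sum>i\<in>UNIV. \<mu> k $ i * (D i k \<bullet> h k)))
        \<longlonglongrightarrow> - (wl \<bullet> ul) + (\<Sum>i\<in>UNIV. l $ i * ((hess (\<lambda>y. q y $ i) x *v ul) \<bullet> ul))"
      by (intro tendsto_intros \<mu>l Dl hl \<omega>l)
    ultimately have "(\<Sum>i\<in>UNIV. (l $ i - l $ i) * (qcurv i x ul / 2))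
        = - (wl \<bullet> ul) + (\<Sum>i\<in>UNIV. l $ i * ((hess (\<lambda>y. q y $ i) x *v ul) \<bullet> ul))"
      by (rule LIMSEQ_unique)
    then show "wl \<bullet> ul = (\<Sum>i\<in>UNIV. l $ i * qcurv i x ul)"
      by (simp add: qcurv_def inner_commute)
  qed
qed

lemma Psi_iff: "v \<in> Psi g q x \<longleftrightarrow> v - grad g x \<in> limiting_normal_cone \<Gamma> x"
  by (auto simp: Psi_def) (metis add.commute diff_add_cancel)

lemma Psi_imp_feasible: "v \<in> Psi g q x \<Longrightarrow> x \<in> \<Gamma>"
  by (auto simp: Psi_iff limiting_normal_cone_def split: if_splits)

section \<open>Prox-regularity of the feasible set\<close>

text \<open>For a multiplier \<open>l\<close> of \<open>v - grad g x\<close> the sum \<open>\<Sum>i. l $ i * q y $ i\<close> is nonpositive at feasible \<open>y\<close>, while its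
  Taylor expansion at \<open>x\<close> begins with \<open>(v - grad g x) \<bullet> (y - x)\<close>. The quadratic remainder is uniform
  since the multipliers are bounded for bounded \<open>v\<close>.\<close>

lemma prox_regular:
  obtains \<rho> where "0 < \<rho>"
    "\<And>x y v. x \<in> U \<inter> cball a R \<Longrightarrow> v \<in> Psi g q x \<Longrightarrow> norm v \<le> 1 \<Longrightarrow> y \<in> \<Gamma> \<inter> cball a R \<Longrightarrow>
      g x + v \<bullet> (y - x) - \<rho> * (norm (y - x))\<^sup>2 \<le> g y"
proof -
  obtain Cg where Cg: "Cg \<ge> 0"
    "\<And>x y. x \<in> cball a R \<Longrightarrow> y \<in> cball a R \<Longrightarrow> \<bar>g y - g x - grad g x \<bullet> (y - x)\<bar> \<le> Cg * (norm (y - x))\<^sup>2"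
    using C2_locally_quadratic[OF C2_g] by metis
  have "\<exists>C\<ge>0. \<forall>x\<in>cball a R. \<forall>y\<in>cball a R. \<bar>q y $ i - q x $ i - dq i x \<bullet> (y - x)\<bar> \<le> C * (norm (y - x))\<^sup>2" for i
    using C2_locally_quadratic[OF C2_q[of i], of a R] unfolding dq_def by metis
  then obtain C where C: "\<And>i. C i \<ge> 0"
    "\<And>i x y. x \<in> cball a R \<Longrightarrow> y \<in> cball a R \<Longrightarrow> \<bar>q y $ i - q x $ i - dq i x \<bullet> (y - x)\<bar> \<le> C i * (norm (y - x))\<^sup>2"
    by metis
  have "continuous_on (cball a R) (grad g)"
    using C2_grad_has_derivative[OF C2_g] by (intro continuous_at_imp_continuous_on ballI has_derivative_continuous)
  then have "bounded (grad g ` cball a R)"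
    by (intro compact_imp_bounded compact_continuous_image) auto
  then obtain G where "G > 0" "\<forall>d\<in>grad g ` cball a R. norm d \<le> G"
    unfolding bounded_pos by blast
  then have G: "G > 0" "\<And>x. x \<in> cball a R \<Longrightarrow> norm (grad g x) \<le> G" by simp_all
  define \<rho> where "\<rho> = Cg + c * (1 + G) * (\<Sum>i\<in>UNIV. C i) + 1"
  show ?thesis
  proof
    have "0 \<le> c * (1 + G) * (\<Sum>i\<in>UNIV. C i)"
      using c_pos G(1) C(1) by (intro mult_nonneg_nonneg sum_nonneg) auto
    then show "0 < \<rho>" using Cg(1) by (simp add: \<rho>_def)
    fix x y v assume x: "x \<in> U \<inter> cball a R" and v: "v \<in> Psi g q x" "norm v \<le> 1" and y: "y \<in> \<Gamma> \<inter> cball a R"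
    define xs where "xs = v - grad g x"
    define N where "N = (norm (y - x))\<^sup>2"
    obtain l where l: "l \<in> multipliers q x xs" "norm l \<le> c * norm xs"
      using limiting_normal_bounded_multiplier[of x xs] x v(1) by (auto simp: Psi_iff xs_def)
    have "norm xs \<le> 1 + G"
      using norm_triangle_ineq4[of v "grad g x"] v(2) G(2)[of x] x by (simp add: xs_def)
    then have "norm l \<le> c * (1 + G)"
      using l(2) c_pos by (meson mult_left_mono less_imp_le order_trans)
    then have l_le: "l $ i \<le> c * (1 + G)" for i
      using component_le_norm_cart[of l i] by linarith
    have "xs \<bullet> (y - x) - c * (1 + G) * (\<Sum>i\<in>UNIV. C i) * N \<le> (\<Sum>i\<in>UNIV. l $ i * (dq i x \<bullet> (y - x)) - l $ i * (C i * N))"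
    proof -
      have "(\<Sum>i\<in>UNIV. l $ i * (C i * N)) \<le> (\<Sum>i\<in>UNIV. c * (1 + G) * (C i * N))"
        using C(1) l_le by (intro sum_mono mult_right_mono) (auto simp: N_def)
      then show ?thesis
        by (simp add: multiplier_inner[OF l(1)] sum_subtractf sum_distrib_left sum_distrib_right mult.assoc)
    qed
    also have "\<dots> \<le> (\<Sum>i\<in>UNIV. l $ i * q y $ i)"
    proof (intro sum_mono)
      fix i
      have "dq i x \<bullet> (y - x) - C i * N \<le> q y $ i - q x $ i"
        using C(2)[of x y i] x y by (simp add: N_def abs_le_iff)
      then have "l $ i * (dq i x \<bullet> (y - x) - C i * N) \<le> l $ i * (q y $ i - q x $ i)"
        using l(1) by (intro mult_left_mono) (auto simp: multipliers_iff)
      then show "l $ i * (dq i x \<bullet> (y - x)) - l $ i * (C i * N) \<le> l $ i * q y $ i"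
        using multiplier_complementary[OF l(1), of i] by (simp add: right_diff_distrib)
    qed
    also have "\<dots> \<le> 0"
      using l(1) y by (intro sum_nonpos) (auto simp: multipliers_iff feasible_iff mult_le_0_iff)
    finally have "xs \<bullet> (y - x) \<le> c * (1 + G) * (\<Sum>i\<in>UNIV. C i) * N" by simp
    moreover have "grad g x \<bullet> (y - x) - Cg * N \<le> g y - g x"
      using Cg(2)[of x y] x y by (simp add: N_def abs_le_iff)
    moreover have "v \<bullet> (y - x) = grad g x \<bullet> (y - x) + xs \<bullet> (y - x)"
      by (simp add: xs_def inner_diff_left)
    moreover have "\<rho> * N = Cg * N + c * (1 + G) * (\<Sum>i\<in>UNIV. C i) * N + N"
      by (simp add: \<rho>_def distrib_right)
    moreover have "0 \<le> N" by (simp add: N_def)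
    ultimately show "g x + v \<bullet> (y - x) - \<rho> * (norm (y - x))\<^sup>2 \<le> g y"
      unfolding N_def[symmetric] by linarith
  qed
qed

lemma hypomonotone:
  assumes prox: "\<And>x y v. x \<in> U \<inter> cball a R \<Longrightarrow> v \<in> Psi g q x \<Longrightarrow> norm v \<le> 1 \<Longrightarrow> y \<in> \<Gamma> \<inter> cball a R \<Longrightarrow>
      g x + v \<bullet> (y - x) - \<rho> * (norm (y - x))\<^sup>2 \<le> g y"
    and 1: "x1 \<in> U \<inter> cball a R" "v1 \<in> Psi g q x1" "norm v1 \<le> 1"
    and 2: "x2 \<in> U \<inter> cball a R" "v2 \<in> Psi g q x2" "norm v2 \<le> 1"
  shows "- 2 * \<rho> * (norm (x1 - x2))\<^sup>2 \<le> (v1 - v2) \<bullet> (x1 - x2)"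
proof -
  have "g x1 + v1 \<bullet> (x2 - x1) - \<rho> * (norm (x2 - x1))\<^sup>2 \<le> g x2"
    using prox[OF 1] 2 Psi_imp_feasible by blast
  moreover have "g x2 + v2 \<bullet> (x1 - x2) - \<rho> * (norm (x1 - x2))\<^sup>2 \<le> g x1"
    using prox[OF 2] 1 Psi_imp_feasible by blast
  moreover have "v1 \<bullet> (x2 - x1) + v2 \<bullet> (x1 - x2) = - ((v1 - v2) \<bullet> (x1 - x2))"
    by (simp add: inner_diff_left inner_diff_right)
  ultimately show ?thesis
    by (simp add: norm_minus_commute[of x2 x1])
qed

end

section \<open>Tilt stability and second-order conditions\<close>

context smooth_program
begin

text \<open>The directions \<open>w\<close> of RUSOSC are the negatives of critical directions; evenness of the
  second-order forms makes this sign immaterial.\<close>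

lemma qcurv_minus [simp]: "qcurv i x (- w) = qcurv i x w"
  by (simp add: qcurv_def linear_neg[OF matrix_vector_mul_linear])

lemma gcurv_minus [simp]: "gcurv x (- w) = gcurv x w"
  by (simp add: gcurv_def linear_neg[OF matrix_vector_mul_linear])

lemma dir_multipliers_iff:
  "l \<in> dir_multipliers q x xs w \<longleftrightarrow> l \<in> multipliers q x xs \<and>
     (\<forall>l'\<in>multipliers q x xs. (\<Sum>i\<in>UNIV. l' $ i * qcurv i x w) \<le> (\<Sum>i\<in>UNIV. l $ i * qcurv i x w))"
  by (auto simp: dir_multipliers_def is_arg_min_def hess_multiplier_form not_less)

end

context subregular_program
begin

text \<open>The points \<open>(s v, v)\<close> exhaust the graph of \<open>Psi\<close> near \<open>(xb, 0)\<close>: for \<open>(x, v)\<close> in the graph, solve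
  \<open>w + r s w = v + r x\<close>; then \<open>(s w, w)\<close> and \<open>(x, v)\<close> both lie in the graph and have the same image under
  \<open>(x, v) \<mapsto> v + r x\<close>, which hypomonotonicity allows only if they coincide. The growth at \<open>s v\<close> then gives a
  multiplier satisfying the second-order inequality, and a solution of the linear program does at
  least as well.\<close>

lemma tilt_stable_imp_second_order:
  assumes xb: "xb \<in> U" and tilt: "tilt_stable_minimizer g q xb \<kappa>"
  shows "RUSOSC g q xb (1 / \<kappa>)"
proof -
  obtain \<gamma> V s where "0 < \<kappa>" "0 < \<gamma>" "open V" "0 \<in> V"
    and am: "\<And>v. v \<in> V \<Longrightarrow> tilt_argmin g \<Gamma> xb \<gamma> v = {s v}"
    and lipV: "\<kappa>-lipschitz_on V s" and s0: "s 0 = xb"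
    using tilt unfolding tilt_stable_minimizer_def by blast
  define S where "S = \<Gamma> \<inter> cball xb \<gamma>"
  have argmin: "s v \<in> S" "\<And>y. y \<in> S \<Longrightarrow> g (s v) - v \<bullet> s v \<le> g y - v \<bullet> y" if "v \<in> V" for v
  proof -
    have "s v \<in> tilt_argmin g \<Gamma> xb \<gamma> v" using am[OF that] by simp
    then show "s v \<in> S" "\<And>y. y \<in> S \<Longrightarrow> g (s v) - v \<bullet> s v \<le> g y - v \<bullet> y"
      by (auto simp: tilt_argmin_def is_arg_min_def S_def not_less)
  qed
  obtain R where R: "R > 0" "cball xb R \<subseteq> U"
    using open_contains_cball[of U] open_U xb by blast
  obtain \<rho> where \<rho>: "0 < \<rho>" and prox:
    "\<And>x y v. x \<in> U \<inter> cball xb R \<Longrightarrow> v \<in> Psi g q x \<Longrightarrow> norm v \<le> 1 \<Longrightarrow> y \<in> \<Gamma> \<inter> cball xb R \<Longrightarrow>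
      g x + v \<bullet> (y - x) - \<rho> * (norm (y - x))\<^sup>2 \<le> g y"
    using prox_regular by metis
  obtain e0 where e0: "e0 > 0" "cball 0 e0 \<subseteq> V"
    using open_contains_cball[of V] \<open>open V\<close> \<open>0 \<in> V\<close> by blast
  \<comment> \<open>small enough for \<open>s\<close> to map into \<open>cball xb R\<close> and into the interior of \<open>cball xb \<gamma>\<close>, where the minimality is a first-order condition\<close>
  define e where "e = Min {e0, 1, R / \<kappa>, \<gamma> / (2 * \<kappa>)}"
  have e: "0 < e" "e \<le> e0" "e \<le> 1" "e \<le> R / \<kappa>" "e \<le> \<gamma> / (2 * \<kappa>)"
    using e0 R \<open>0 < \<kappa>\<close> \<open>0 < \<gamma>\<close> by (auto simp: e_def)
  have eR: "\<kappa> * e \<le> R" and e\<gamma>: "\<kappa> * e < \<gamma>"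
    using e \<open>0 < \<kappa>\<close> \<open>0 < \<gamma>\<close> by (auto simp: field_simps)
  have inV: "cball 0 e \<subseteq> V" using e0 e by auto
  have lip: "\<kappa>-lipschitz_on (cball 0 e) s" by (rule lipschitz_on_subset[OF lipV inV])
  have s_near: "dist (s w) xb \<le> \<kappa> * e" if "w \<in> cball 0 e" for w
  proof -
    have "dist (s w) (s 0) \<le> \<kappa> * dist w 0"
      using that e(1) by (intro lipschitz_onD[OF lip]) auto
    also have "\<dots> \<le> \<kappa> * e"
      using that \<open>0 < \<kappa>\<close> by (intro mult_left_mono) (auto simp: dist_commute)
    finally show ?thesis by (simp add: s0)
  qed
  have s_Psi: "w \<in> Psi g q (s w)" if w: "w \<in> cball 0 e" for w
  proof -
    have "- (grad g (s w) - w) \<in> limiting_normal_cone \<Gamma> (s w)"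
    proof (rule local_minimizer_imp_normal)
      show "s w \<in> \<Gamma>" using argmin(1) w inV by (auto simp: S_def)
      show "((\<lambda>y. g y - w \<bullet> y) has_derivative (\<lambda>h. (grad g (s w) - w) \<bullet> h)) (at (s w))"
        by (rule has_derivative_eq_rhs[OF has_derivative_diff[OF C2_has_derivative[OF C2_g]
              bounded_linear_imp_has_derivative[OF bounded_linear_inner_right]]])
           (simp add: fun_eq_iff inner_diff_left)
      show "\<gamma> - \<kappa> * e > 0" using e\<gamma> by simp
      fix y' assume "y' \<in> \<Gamma>" "dist y' (s w) < \<gamma> - \<kappa> * e"
      then have "y' \<in> S"
        using s_near[OF w] dist_triangle[of xb y' "s w"] by (auto simp: S_def dist_commute)
      then show "g (s w) - w \<bullet> s w \<le> g y' - w \<bullet> y'"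
        using argmin(2) w inV by blast
    qed
    then show ?thesis by (simp add: Psi_iff)
  qed
  have growth: "g (s v) + v \<bullet> (y - s v) + (norm (y - s v))\<^sup>2 / (2 * \<kappa>) \<le> g y"
    if "v \<in> cball 0 e" "y \<in> S" "v + (y - s v) /\<^sub>R \<kappa> \<in> cball 0 e" for v y
    by (rule argmin_quadratic_growth[OF _ _ lip \<open>0 < \<kappa>\<close> convex_cball that(1,2,3)])
       (use argmin inV in auto)
  \<comment> \<open>the graph of \<open>Psi\<close> is hypomonotone with constant \<open>2 * \<rho>\<close>, so shifting by any \<open>r > 2 * \<rho>\<close> makes it strongly monotone\<close>
  define r where "r = 2 * \<rho> + 1"
  define \<eta> where "\<eta> = Min {e / (2 * (1 + r)), R, 1, e / 2, \<gamma> / 2}"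
  have "r > 0" using \<rho> by (simp add: r_def)
  then have "0 < \<eta>"
    using e(1) R \<open>0 < \<gamma>\<close> by (simp add: \<eta>_def)
  moreover have "\<eta> \<le> e / (2 * (1 + r))" "\<eta> \<le> R" "\<eta> \<le> 1" "\<eta> \<le> e / 2" "\<eta> \<le> \<gamma> / 2"
    unfolding \<eta>_def by (intro Min_le; simp)+
  ultimately have \<eta>: "0 < \<eta>" "\<eta> \<le> e / (2 * (1 + r))" "\<eta> \<le> R" "\<eta> \<le> 1" "\<eta> \<le> e / 2" "\<eta> \<le> \<gamma> / 2"
    by blast+
  have s_graph: "s v = x" if xv: "v \<in> Psi g q x" "dist x xb \<le> \<eta>" "norm v \<le> \<eta>" for x v
  proof -
    have "norm ((v + r *\<^sub>R x) - r *\<^sub>R xb) \<le> norm v + r * dist x xb"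
      using norm_add_scaleR_le[of r v "x - xb"] \<open>r > 0\<close>
      by (simp add: dist_norm scaleR_diff_right add_diff_eq)
    also have "\<dots> \<le> \<eta> + r * \<eta>"
      using xv \<open>r > 0\<close> by (intro add_mono mult_left_mono) auto
    also have "\<dots> = \<eta> * (1 + r)" by (simp add: algebra_simps)
    also have "\<dots> < e"
    proof -
      have "\<eta> * (1 + r) \<le> (e / (2 * (1 + r))) * (1 + r)"
        using \<eta>(2) \<open>r > 0\<close> by (intro mult_right_mono) auto
      also have "\<dots> = e / 2" using \<open>r > 0\<close> by (simp add: field_simps)
      finally show ?thesis using e(1) by simp
    qed
    finally have "norm ((v + r *\<^sub>R x) - r *\<^sub>R s 0) < e" by (simp add: s0)
    moreover have "0 \<le> (s w - s 0) \<bullet> w" if "w \<in> cball 0 e" for w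
    proof -
      have w: "w \<in> V" and 0: "0 \<in> V" using that inV \<open>0 \<in> V\<close> by auto
      show ?thesis
        using argmin(2)[OF w argmin(1)[OF 0]] argmin(2)[OF 0 argmin(1)[OF w]]
        by (simp add: inner_diff_right inner_commute)
    qed
    ultimately obtain w where w: "w \<in> cball 0 e" "w + r *\<^sub>R s w = v + r *\<^sub>R x"
      using monotone_plus_identity_solvable[of e s r "v + r *\<^sub>R x"] lipschitz_on_continuous_on[OF lip] \<open>r > 0\<close>
      by (metis less_imp_le)
    have "s w \<in> U \<inter> cball xb R" "norm w \<le> 1"
      using s_near[OF w(1)] eR R(2) w(1) e(3) by (auto simp: dist_commute)
    moreover have "x \<in> U \<inter> cball xb R" "norm v \<le> 1"
      using xv \<eta> R(2) by (auto simp: dist_commute)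
    ultimately have "- 2 * \<rho> * (norm (s w - x))\<^sup>2 \<le> (w - v) \<bullet> (s w - x)"
      using hypomonotone[OF prox] s_Psi[OF w(1)] xv(1) by blast
    also have "w - v = - r *\<^sub>R (s w - x)"
      using w(2) by (simp add: algebra_simps)
    also have "(- r *\<^sub>R (s w - x)) \<bullet> (s w - x) = - r * (norm (s w - x))\<^sup>2"
      by (simp only: inner_scaleR_left power2_norm_eq_inner)
    finally have "(norm (s w - x))\<^sup>2 \<le> 0"
      by (simp add: r_def algebra_simps)
    then have "s w = x" by simp
    with w show ?thesis by simp
  qed
  show ?thesis
    unfolding RUSOSC_def
  proof (intro conjI exI[of _ \<eta>] allI impI)
    show "0 < 1 / \<kappa>" "0 < \<eta>" using \<open>0 < \<kappa>\<close> \<eta>(1) by auto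
    fix x v lam w
    assume xv: "(x, v) \<in> gph (Psi g q) \<inter> cball (xb, 0) \<eta>"
      and lam: "lam \<in> dir_multipliers q x (v - grad g x) w"
      and w: "\<forall>i\<in>pos_indices lam. grad (\<lambda>y. q y $ i) x \<bullet> w = 0"
        "\<forall>i\<in>active q x - pos_indices lam. 0 \<le> grad (\<lambda>y. q y $ i) x \<bullet> w"
    have Psi: "v \<in> Psi g q x" using xv by (simp add: gph_def)
    have near: "dist x xb \<le> \<eta>" "norm v \<le> \<eta>"
      using xv dist_fst_le[of "(xb, 0)" "(x, v)"] dist_snd_le[of "(xb, 0)" "(x, v)"]
      by (auto simp: dist_commute)
    have sv: "s v = x" by (rule s_graph[OF Psi near])
    have ve: "v \<in> cball 0 e" using near(2) \<eta>(5) e(1) by simp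
    have mult: "lam \<in> multipliers q x (v - grad g x)"
      and max: "\<And>l'. l' \<in> multipliers q x (v - grad g x) \<Longrightarrow>
        (\<Sum>i\<in>UNIV. l' $ i * qcurv i x w) \<le> (\<Sum>i\<in>UNIV. lam $ i * qcurv i x w)"
      using lam by (auto simp: dir_multipliers_iff)
    have xU: "x \<in> U" using near \<eta>(3) R(2) by (auto simp: dist_commute)
    obtain l where l: "l \<in> multipliers q x (v - grad g x)"
      "1 / \<kappa> * (norm (- w))\<^sup>2 \<le> gcurv x (- w) + (\<Sum>i\<in>UNIV. l $ i * qcurv i x (- w))"
    proof (rule second_order_necessary_condition[OF Psi_imp_feasible[OF Psi] xU mult])
      show "dq i x \<bullet> - w \<le> 0" if "i \<in> active q x" for i
        using w that by (cases "i \<in> pos_indices lam") (auto simp: dq_def)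
      show "dq i x \<bullet> - w = 0" if "0 < lam $ i" for i
        using w(1) that by (auto simp: dq_def pos_indices_def)
      show "0 < min (\<kappa> * e / 2) (\<gamma> / 2)" using \<open>0 < \<kappa>\<close> \<open>0 < \<gamma>\<close> e(1) by simp
      fix y assume y: "y \<in> \<Gamma>" "dist y x < min (\<kappa> * e / 2) (\<gamma> / 2)"
      have "y \<in> S"
        using y near \<eta>(6) dist_triangle[of xb y x] by (auto simp: S_def dist_commute)
      moreover have "v + (y - s v) /\<^sub>R \<kappa> \<in> cball 0 e"
      proof -
        have "norm ((y - x) /\<^sub>R \<kappa>) \<le> e / 2"
          unfolding norm_scaleR using y(2) \<open>0 < \<kappa>\<close> by (simp add: dist_norm field_simps)
        then have "norm (v + (y - x) /\<^sub>R \<kappa>) \<le> e / 2 + e / 2"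
          using near(2) \<eta>(5) by (intro norm_triangle_le) linarith
        then show ?thesis by (simp add: sv)
      qed
      ultimately show "g x + v \<bullet> (y - x) + 1 / \<kappa> * (norm (y - x))\<^sup>2 / 2 \<le> g y"
        using growth[OF ve, of y] by (simp add: sv mult.commute)
    qed
    then show "1 / \<kappa> * (norm w)\<^sup>2 \<le> (hess (\<lambda>y. Lagr g q y lam) x *v w) \<bullet> w"
      using max[OF l(1)] by (simp add: hess_Lagr_form)
  qed
qed

text \<open>The regularized solution map \<open>P\<close> exists by compactness and is single-valued and Lipschitz by
  hypomonotonicity. A tangent \<open>(hl, ul)\<close> of its graph, with \<open>hl\<close> the change of \<open>z\<close>, satisfies
  \<open>(r + 1 / \<kappa>) \<parallel>ul\<parallel>\<^sup>2 \<le> hl \<bullet> ul\<close> by the second-order condition, which bounds the slope of \<open>P\<close> by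
  \<open>L = 1 / (r + 1 / \<kappa>)\<close>. Removing the regularization is a contraction argument with constant \<open>r L\<close>, and
  \<open>(1 - r L) / L = 1 / \<kappa>\<close> returns exactly the modulus \<open>\<kappa>\<close>.\<close>

lemma second_order_imp_tilt_stable:
  assumes xb: "xb \<in> U" "0 \<in> Psi g q xb" and "0 < \<kappa>" and "c \<le> \<gamma>" and "0 < \<eta>"
    and so: "\<And>x v lam w. (x, v) \<in> gph (Psi g q) \<inter> cball (xb, 0) \<eta> \<Longrightarrow>
        lam \<in> dir_multipliers q x (v - grad g x) w \<inter> cball 0 (\<gamma> * norm (v - grad g x)) \<Longrightarrow>
        \<forall>i\<in>pos_indices lam. grad (\<lambda>y. q y $ i) x \<bullet> w = 0 \<Longrightarrow>
        \<forall>i\<in>active q x - pos_indices lam. 0 \<le> grad (\<lambda>y. q y $ i) x \<bullet> w \<Longrightarrow>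
        1 / \<kappa> * (norm w)\<^sup>2 \<le> (hess (\<lambda>y. Lagr g q y lam) x *v w) \<bullet> w"
  shows "tilt_stable_minimizer g q xb \<kappa>"
proof -
  have xbG: "xb \<in> \<Gamma>" by (rule Psi_imp_feasible[OF xb(2)])
  obtain R where R: "R > 0" "cball xb R \<subseteq> U"
    using open_contains_cball[of U] open_U xb(1) by blast
  obtain \<rho> where \<rho>: "0 < \<rho>" and prox:
    "\<And>x y v. x \<in> U \<inter> cball xb R \<Longrightarrow> v \<in> Psi g q x \<Longrightarrow> norm v \<le> 1 \<Longrightarrow> y \<in> \<Gamma> \<inter> cball xb R \<Longrightarrow>
      g x + v \<bullet> (y - x) - \<rho> * (norm (y - x))\<^sup>2 \<le> g y"
    using prox_regular by metis
  define r where "r = 2 * \<rho> + 1"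
  have r1: "r \<ge> 1" using \<rho> by (simp add: r_def)
  define S where "S = \<Gamma> \<inter> cball xb R"
  have "compact S" unfolding S_def by (intro closed_Int_compact closed_feasible compact_cball)
  define F where "F y = g y + r / 2 * (y \<bullet> y)" for y
  have F_diff: "F y - F x = g y - g x + r * (x \<bullet> (y - x)) + r / 2 * (norm (y - x))\<^sup>2" for x y
    by (simp add: F_def power2_norm_eq_inner inner_diff_left inner_diff_right inner_commute algebra_simps)
  have F_deriv: "(F has_derivative (\<lambda>h. (grad g y + r *\<^sub>R y) \<bullet> h)) (at y)" for y
    unfolding F_def[abs_def]
    by (rule has_derivative_eq_rhs[OF has_derivative_add[OF C2_has_derivative[OF C2_g]
          has_derivative_mult_right[OF has_derivative_inner[OF has_derivative_ident has_derivative_ident]]]])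
       (simp add: fun_eq_iff inner_add_right inner_commute)
  have F_cont: "continuous_on A F" for A
    using F_deriv by (intro continuous_at_imp_continuous_on ballI has_derivative_continuous)
  have "\<exists>x\<in>S. \<forall>y\<in>S. F x - z \<bullet> x \<le> F y - z \<bullet> y" for z
  proof (rule continuous_attains_inf[OF \<open>compact S\<close>])
    show "S \<noteq> {}" using xbG R(1) by (auto simp: S_def)
    show "continuous_on S (\<lambda>x. F x - z \<bullet> x)" by (intro continuous_intros F_cont)
  qed
  then obtain P where P: "\<And>z. P z \<in> S" "\<And>z y. y \<in> S \<Longrightarrow> F (P z) - z \<bullet> P z \<le> F y - z \<bullet> y"
    by metis
  \<comment> \<open>prox-regularity at \<open>(xb, 0)\<close> makes \<open>xb\<close> a strong minimizer of \<open>F y - r * (xb \<bullet> y)\<close> over \<open>S\<close>\<close>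
  have P_near: "dist (P z) xb \<le> 2 * dist z (r *\<^sub>R xb)" for z
  proof -
    define d where "d = P z - xb"
    have "xb \<in> U \<inter> cball xb R" "P z \<in> \<Gamma> \<inter> cball xb R" "xb \<in> S"
      using xb(1) xbG R(1) P(1) by (auto simp: S_def)
    then have *: "- (\<rho> * (norm d)\<^sup>2) \<le> g (P z) - g xb" "F (P z) - F xb \<le> z \<bullet> d"
      using prox[OF _ xb(2), of "P z"] P(2)[of xb z] by (auto simp: d_def inner_diff_right)
    then have "(norm d)\<^sup>2 / 2 \<le> z \<bullet> d - r * (xb \<bullet> d)"
    proof -
      have "r / 2 * (norm d)\<^sup>2 = \<rho> * (norm d)\<^sup>2 + (norm d)\<^sup>2 / 2"
        by (simp add: r_def distrib_right add_divide_distrib)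
      with * show ?thesis
        unfolding F_diff d_def[symmetric] by linarith
    qed
    also have "\<dots> = (z - r *\<^sub>R xb) \<bullet> d" by (simp add: inner_diff_left)
    also have "\<dots> \<le> norm (z - r *\<^sub>R xb) * norm d" by (rule norm_cauchy_schwarz)
    finally have "norm d * norm d \<le> (2 * norm (z - r *\<^sub>R xb)) * norm d"
      by (simp add: power2_eq_square)
    then have "norm d \<le> 2 * norm (z - r *\<^sub>R xb)"
      by (cases "norm d = 0") (auto dest: mult_right_le_imp_le)
    then show ?thesis by (simp add: d_def dist_norm)
  qed
  \<comment> \<open>for \<open>z\<close> in \<open>B\<close>, the point \<open>P z\<close> is interior to \<open>cball xb R\<close>, and \<open>(P z, z - r P z)\<close> is within \<open>\<eta>\<close> of \<open>(xb, 0)\<close>\<close>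
  define \<epsilon> where "\<epsilon> = Min {R / 3, 1 / (4 + 2 * r), \<eta> / (4 + 2 * r)}"
  have \<epsilon>: "0 < \<epsilon>" "\<epsilon> \<le> R / 3" "\<epsilon> * (4 + 2 * r) \<le> 1" "\<epsilon> * (4 + 2 * r) \<le> \<eta>"
  proof -
    have "\<epsilon> \<le> 1 / (4 + 2 * r)" "\<epsilon> \<le> \<eta> / (4 + 2 * r)" by (auto simp: \<epsilon>_def)
    then show "\<epsilon> * (4 + 2 * r) \<le> 1" "\<epsilon> * (4 + 2 * r) \<le> \<eta>"
      using r1 by (simp_all add: pos_le_divide_eq)
    show "0 < \<epsilon>" using R(1) \<open>0 < \<eta>\<close> r1 by (simp add: \<epsilon>_def)
    show "\<epsilon> \<le> R / 3" unfolding \<epsilon>_def by (intro Min_le) auto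
  qed
  define B where "B = cball (r *\<^sub>R xb) \<epsilon>"
  have P_dist: "dist (P z) xb \<le> 2 * \<epsilon>" if "z \<in> B" for z
    using P_near[of z] that by (simp add: B_def dist_commute)
  have P_v: "norm (z - r *\<^sub>R P z) \<le> \<epsilon> * (1 + 2 * r)" if "z \<in> B" for z
  proof -
    have "norm (z - r *\<^sub>R P z) \<le> dist z (r *\<^sub>R xb) + r * dist (P z) xb"
      using norm_add_scaleR_le[of r "z - r *\<^sub>R xb" "xb - P z"] r1
      by (simp add: dist_norm norm_minus_commute[of xb] scaleR_diff_right)
    also have "\<dots> \<le> \<epsilon> + r * (2 * \<epsilon>)"
      using that P_dist[OF that] r1 by (intro add_mono mult_left_mono) (auto simp: B_def dist_commute)
    finally show ?thesis by (simp add: algebra_simps)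
  qed
  have P_Psi: "z - r *\<^sub>R P z \<in> Psi g q (P z)" if "z \<in> B" for z
  proof -
    have "- (grad g (P z) + r *\<^sub>R P z - z) \<in> limiting_normal_cone \<Gamma> (P z)"
    proof (rule local_minimizer_imp_normal)
      show "P z \<in> \<Gamma>" using P(1) by (simp add: S_def)
      show "((\<lambda>y. F y - z \<bullet> y) has_derivative (\<lambda>h. (grad g (P z) + r *\<^sub>R P z - z) \<bullet> h)) (at (P z))"
        by (rule has_derivative_eq_rhs[OF has_derivative_diff[OF F_deriv
              bounded_linear_imp_has_derivative[OF bounded_linear_inner_right]]])
           (simp add: fun_eq_iff inner_diff_left)
      show "R / 3 > 0" using R by simp
      fix y' assume "y' \<in> \<Gamma>" "dist y' (P z) < R / 3"
      then have "y' \<in> S"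
        using P_dist[OF that] \<epsilon>(2) dist_triangle[of xb y' "P z"] by (auto simp: S_def dist_commute)
      then show "F (P z) - z \<bullet> P z \<le> F y' - z \<bullet> y'" by (rule P(2))
    qed
    then show ?thesis by (simp add: Psi_iff algebra_simps)
  qed
  have P_U: "P z \<in> U \<inter> cball xb R" for z
    using P(1)[of z] R(2) by (auto simp: S_def)
  have P_le1: "norm (z - r *\<^sub>R P z) \<le> 1" if "z \<in> B" for z
    using P_v[OF that] \<epsilon>(1,3) by (simp add: algebra_simps)
  have P_gph: "(P z, z - r *\<^sub>R P z) \<in> gph (Psi g q) \<inter> cball (xb, 0) \<eta>" if "z \<in> B" for z
  proof -
    have "dist (xb, 0) (P z, z - r *\<^sub>R P z) \<le> dist xb (P z) + dist 0 (z - r *\<^sub>R P z)"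
      unfolding dist_Pair_Pair by (rule sqrt_sum_squares_le_sum) auto
    also have "\<dots> \<le> 2 * \<epsilon> + \<epsilon> * (1 + 2 * r)"
      using P_dist[OF that] P_v[OF that] by (simp add: dist_commute add_mono)
    also have "\<dots> \<le> \<eta>"
      using \<epsilon>(1,4) by (simp add: algebra_simps)
    finally show ?thesis using P_Psi[OF that] by (simp add: gph_def)
  qed
  have P_lip: "norm (P z - P z') \<le> norm (z - z')" if "z \<in> B" "z' \<in> B" for z z'
  proof -
    define d where "d = P z - P z'"
    have "- 2 * \<rho> * (norm d)\<^sup>2 \<le> ((z - r *\<^sub>R P z) - (z' - r *\<^sub>R P z')) \<bullet> d"
      unfolding d_def using that by (intro hypomonotone[OF prox P_U P_Psi P_le1 P_U P_Psi P_le1])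
    also have "(z - r *\<^sub>R P z) - (z' - r *\<^sub>R P z') = (z - z') - r *\<^sub>R d"
      by (simp add: d_def algebra_simps)
    also have "((z - z') - r *\<^sub>R d) \<bullet> d = (z - z') \<bullet> d - r * (norm d)\<^sup>2"
      by (simp add: inner_diff_left power2_norm_eq_inner del: inner_real_def)
    finally have "(norm d)\<^sup>2 \<le> (z - z') \<bullet> d"
      by (simp add: r_def algebra_simps)
    also have "\<dots> \<le> norm (z - z') * norm d" by (rule norm_cauchy_schwarz)
    finally have "norm d * norm d \<le> norm (z - z') * norm d" by (simp add: power2_eq_square)
    then show ?thesis
      unfolding d_def[symmetric] by (cases "norm d = 0") (auto dest: mult_right_le_imp_le)
  qed
  define L where "L = 1 / (r + 1 / \<kappa>)"
  have L: "L > 0" "1 / L = r + 1 / \<kappa>" "L * (r + 1 / \<kappa>) = 1"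
  proof -
    have "0 < r + 1 / \<kappa>" using r1 \<open>0 < \<kappa>\<close> by (intro add_pos_pos) auto
    then show "L > 0" "1 / L = r + 1 / \<kappa>" "L * (r + 1 / \<kappa>) = 1" by (simp_all add: L_def)
  qed
  have lipP: "L-lipschitz_on B P"
  proof (rule lipschitz_if_pointwise_slope_bound)
    show "convex B" by (simp add: B_def)
    show "0 \<le> L" using L(1) by simp
    fix z L' assume z: "z \<in> B" and "L < L'"
    show "\<exists>d>0. \<forall>z'\<in>B. dist z' z < d \<longrightarrow> dist (P z') (P z) \<le> L' * dist z' z"
    proof (rule ccontr)
      assume neg: "\<not> ?thesis"
      have "\<exists>z'\<in>B. dist z' z < inverse (real (Suc k)) \<and> L' * dist z' z < dist (P z') (P z)" for k
        using neg by (metis inverse_positive_iff_positive not_less of_nat_0_less_iff zero_less_Suc)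
      then obtain Z where Z: "\<And>k. Z k \<in> B" "\<And>k. dist (Z k) z < inverse (real (Suc k))"
        "\<And>k. L' * dist (Z k) z < dist (P (Z k)) (P z)" by metis
      define t where "t k = dist (Z k) z" for k
      have t: "0 < t k" for k
        using Z(3)[of k] unfolding t_def by (cases "Z k = z") auto
      have t0: "t \<longlonglongrightarrow> 0"
        by (rule Lim_null_comparison[OF _ LIMSEQ_inverse_real_of_nat])
           (use Z(2) in \<open>auto simp: t_def less_imp_le simp del: of_nat_Suc\<close>)
      define u where "u k = (P (Z k) - P z) /\<^sub>R t k" for k
      define h where "h k = (Z k - z) /\<^sub>R t k" for k
      have nu: "norm (u k) = norm (P (Z k) - P z) / t k" and nh: "norm (h k) = norm (Z k - z) / t k" for k
        unfolding u_def h_def norm_scaleR using t[of k] by (simp_all add: field_simps)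
      have h1: "norm (h k) = 1" for k
        using t[of k] by (simp add: nh t_def dist_norm)
      have u1: "norm (u k) \<le> 1" for k
        using P_lip[OF Z(1) z, of k] t[of k] unfolding nu by (simp add: t_def dist_norm)
      have uL: "L' \<le> norm (u k)" for k
        using Z(3)[of k] t[of k] unfolding nu by (simp add: t_def dist_norm pos_le_divide_eq)
      have "norm (u k, h k) \<le> 2" for k
        using norm_Pair_le[of "u k" "h k"] u1[of k] h1[of k] by simp
      then obtain p \<sigma> where \<sigma>: "strict_mono \<sigma>" "((\<lambda>k. (u k, h k)) \<circ> \<sigma>) \<longlonglongrightarrow> p"
        by (rule cball_cluster_point)
      define ul hl where "ul = fst p" and "hl = snd p"
      have u\<sigma>: "(\<lambda>k. u (\<sigma> k)) \<longlonglongrightarrow> ul" and h\<sigma>: "(\<lambda>k. h (\<sigma> k)) \<longlonglongrightarrow> hl"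
        using tendsto_fst[OF \<sigma>(2)] tendsto_snd[OF \<sigma>(2)] by (simp_all add: o_def ul_def hl_def)
      have t\<sigma>: "0 < t (\<sigma> k)" "(\<lambda>k. t (\<sigma> k)) \<longlonglongrightarrow> 0" for k
        using t LIMSEQ_subseq_LIMSEQ[OF t0 \<sigma>(1)] by (simp_all add: o_def)
      define x where "x = P z"
      define xs where "xs = z - r *\<^sub>R x - grad g x"
      define G where "G k = (grad g (x + t (\<sigma> k) *\<^sub>R u (\<sigma> k)) - grad g x) /\<^sub>R t (\<sigma> k)" for k
      have Gl: "G \<longlonglongrightarrow> hess g x *v ul"
        unfolding G_def[abs_def] by (rule difference_quotient_tendsto[OF C2_grad_has_derivative[OF C2_g] t\<sigma> u\<sigma>])
      define \<omega> where "\<omega> k = h (\<sigma> k) - r *\<^sub>R u (\<sigma> k) - G k" for k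
      have \<omega>l: "\<omega> \<longlonglongrightarrow> hl - r *\<^sub>R ul - hess g x *v ul"
        unfolding \<omega>_def[abs_def] by (intro tendsto_intros h\<sigma> u\<sigma> Gl)
      have xZ: "x + t (\<sigma> k) *\<^sub>R u (\<sigma> k) = P (Z (\<sigma> k))" for k
        using t[of "\<sigma> k"] by (simp add: u_def x_def)
      have zZ: "t (\<sigma> k) *\<^sub>R h (\<sigma> k) = Z (\<sigma> k) - z" for k
        using t[of "\<sigma> k"] by (simp add: h_def)
      have xsZ: "xs + t (\<sigma> k) *\<^sub>R \<omega> k = (Z (\<sigma> k) - r *\<^sub>R P (Z (\<sigma> k))) - grad g (P (Z (\<sigma> k)))" for k
      proof -
        have "t (\<sigma> k) *\<^sub>R G k = grad g (P (Z (\<sigma> k))) - grad g x"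
          using t[of "\<sigma> k"] by (simp add: G_def xZ)
        moreover have "t (\<sigma> k) *\<^sub>R u (\<sigma> k) = P (Z (\<sigma> k)) - x"
          using xZ[of k] by (simp add: algebra_simps)
        then have "t (\<sigma> k) *\<^sub>R r *\<^sub>R u (\<sigma> k) = r *\<^sub>R (P (Z (\<sigma> k)) - x)"
          by (metis scaleR_left_commute)
        ultimately show ?thesis
          using zZ[of k] by (simp add: xs_def \<omega>_def scaleR_diff_right)
      qed
      have xG: "x \<in> \<Gamma>" using P(1) by (simp add: x_def S_def)
      obtain l where l: "l \<in> multipliers q x xs" "norm l \<le> c * norm xs"
        "\<And>l'. l' \<in> multipliers q x xs \<Longrightarrow> (\<Sum>i\<in>UNIV. l' $ i * qcurv i x ul) \<le> (\<Sum>i\<in>UNIV. l $ i * qcurv i x ul)"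
        "\<And>i. i \<in> active q x \<Longrightarrow> dq i x \<bullet> ul \<le> 0" "\<And>i. 0 < l $ i \<Longrightarrow> dq i x \<bullet> ul = 0"
        "(hl - r *\<^sub>R ul - hess g x *v ul) \<bullet> ul = (\<Sum>i\<in>UNIV. l $ i * qcurv i x ul)"
      proof (rule normal_cone_graphical_derivative[OF xG t\<sigma> u\<sigma> \<omega>l, of xs])
        show "x + t (\<sigma> k) *\<^sub>R u (\<sigma> k) \<in> U" for k
          unfolding xZ using P_U by blast
        show "xs + t (\<sigma> k) *\<^sub>R \<omega> k \<in> limiting_normal_cone \<Gamma> (x + t (\<sigma> k) *\<^sub>R u (\<sigma> k))" for k
          unfolding xZ xsZ Psi_iff[symmetric] using P_Psi Z(1) by blast
      qed blast
      \<comment> \<open>\<open>ul\<close> is a critical direction, hence \<open>- ul\<close> satisfies the sign conditions\<close>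
      have "1 / \<kappa> * (norm (- ul))\<^sup>2 \<le> (hess (\<lambda>y. Lagr g q y l) x *v (- ul)) \<bullet> (- ul)"
      proof (rule so)
        show "(x, z - r *\<^sub>R x) \<in> gph (Psi g q) \<inter> cball (xb, 0) \<eta>"
          using P_gph[OF z] by (simp add: x_def)
        have "norm l \<le> \<gamma> * norm xs"
          using l(2) \<open>c \<le> \<gamma>\<close> by (meson mult_right_mono norm_ge_zero order_trans)
        then show "l \<in> dir_multipliers q x (z - r *\<^sub>R x - grad g x) (- ul)
            \<inter> cball 0 (\<gamma> * norm (z - r *\<^sub>R x - grad g x))"
          using l(1,3) by (simp add: dir_multipliers_iff flip: xs_def)
      qed (use l(4,5) in \<open>auto simp: pos_indices_def dq_def\<close>)
      then have "1 / \<kappa> * (norm ul)\<^sup>2 \<le> gcurv x ul + (\<Sum>i\<in>UNIV. l $ i * qcurv i x ul)"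
        by (simp only: hess_Lagr_form gcurv_minus qcurv_minus norm_minus_cancel)
      also have "\<dots> = gcurv x ul + (hl \<bullet> ul - r * (norm ul)\<^sup>2 - gcurv x ul)"
      proof -
        have "(hl - r *\<^sub>R ul - hess g x *v ul) \<bullet> ul = hl \<bullet> ul - r * (norm ul)\<^sup>2 - gcurv x ul"
          by (simp only: inner_diff_left inner_scaleR_left power2_norm_eq_inner gcurv_def inner_commute[of "hess g x *v ul"])
        with l(6) show ?thesis by simp
      qed
      finally have "(r + 1 / \<kappa>) * (norm ul)\<^sup>2 \<le> hl \<bullet> ul"
        by (simp add: algebra_simps)
      also have "\<dots> \<le> norm hl * norm ul" by (rule norm_cauchy_schwarz)
      also have "\<dots> \<le> 1 * norm ul"
      proof (rule mult_right_mono)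
        have "(\<lambda>k. norm (h (\<sigma> k))) \<longlonglongrightarrow> norm hl" by (intro tendsto_intros h\<sigma>)
        then show "norm hl \<le> 1" by (simp add: h1 LIMSEQ_const_iff)
      qed simp
      finally have *: "(r + 1 / \<kappa>) * (norm ul)\<^sup>2 \<le> norm ul" by simp
      have "L' \<le> norm ul"
      proof (rule LIMSEQ_le_const)
        show "(\<lambda>k. norm (u (\<sigma> k))) \<longlonglongrightarrow> norm ul" by (intro tendsto_intros u\<sigma>)
      qed (use uL in auto)
      then have "L < norm ul" using \<open>L < L'\<close> by simp
      then have "norm ul > 0" using L(1) by linarith
      have "1 * norm ul = L * ((r + 1 / \<kappa>) * norm ul)"
        using L(3) by (simp only: mult.assoc[symmetric])
      also have "\<dots> < norm ul * ((r + 1 / \<kappa>) * norm ul)"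
        using \<open>L < norm ul\<close> \<open>norm ul > 0\<close> r1 \<open>0 < \<kappa>\<close> by (intro mult_strict_right_mono mult_pos_pos add_pos_pos) auto
      also have "\<dots> \<le> norm ul" using * by (simp add: power2_eq_square mult.left_commute)
      finally show False by simp
    qed
  qed
  have growth: "g (P z) + (z - r *\<^sub>R P z) \<bullet> (y - P z) + (norm (y - P z))\<^sup>2 / (2 * \<kappa>) \<le> g y"
    if "z \<in> B" "y \<in> S" "z + (y - P z) /\<^sub>R L \<in> B" for z y
  proof -
    define N where "N = (norm (y - P z))\<^sup>2"
    have "convex B" by (simp add: B_def)
    have "F (P z) + z \<bullet> (y - P z) + N / (2 * L) \<le> F y"
      unfolding N_def
      by (rule argmin_quadratic_growth[where f = F, OF _ _ lipP L(1) \<open>convex B\<close> that]) (use P in auto)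
    moreover have "N / (2 * L) = (1 / L) * N / 2" by simp
    moreover have "F y - F (P z) = g y - g (P z) + r * (P z \<bullet> (y - P z)) + r / 2 * N"
      unfolding N_def by (rule F_diff)
    moreover have "(1 / L) * N / 2 = r / 2 * N + N / (2 * \<kappa>)"
      unfolding L(2) by (simp add: distrib_right add_divide_distrib)
    moreover have "(z - r *\<^sub>R P z) \<bullet> (y - P z) = z \<bullet> (y - P z) - r * (P z \<bullet> (y - P z))"
      by (simp only: inner_diff_left inner_scaleR_left)
    ultimately show ?thesis
      unfolding N_def[symmetric] by linarith
  qed
  have P_xb: "P (r *\<^sub>R xb) = xb"
    using P_near[of "r *\<^sub>R xb"] by simp
  have xbB: "r *\<^sub>R xb \<in> B" using \<epsilon>(1) by (simp add: B_def)
  \<comment> \<open>with these radii \<open>v + r y\<close> stays within \<open>\<epsilon> / 3\<close> of \<open>r xb\<close>, which leaves \<open>2 * \<epsilon> / 3\<close> for the shift \<open>(y - P z) / L\<close> in the growth inequality\<close>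
  define \<delta> where "\<delta> = \<epsilon> * L / 3"
  define e where "e = \<delta> / \<kappa>"
  have \<delta>: "0 < \<delta>" "\<delta> / L = \<epsilon> / 3" using \<epsilon>(1) L(1) by (simp_all add: \<delta>_def)
  have e: "0 < e" "e + r * \<delta> = \<epsilon> / 3"
  proof -
    show "0 < e" using \<delta> \<open>0 < \<kappa>\<close> by (simp add: e_def)
    have "e + r * \<delta> = \<delta> * (r + 1 / \<kappa>)" by (simp add: e_def algebra_simps)
    also have "\<dots> = \<epsilon> / 3 * (L * (r + 1 / \<kappa>))" by (simp only: \<delta>_def) simp
    finally show "e + r * \<delta> = \<epsilon> / 3" using L(3) by simp
  qed
  have "1 \<le> r + 1 / \<kappa>" using r1 \<open>0 < \<kappa>\<close> by (intro add_increasing2) auto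
  then have "L \<le> 1" by (simp add: L_def divide_le_eq_1)
  then have "\<epsilon> * L \<le> \<epsilon>" using \<epsilon>(1) by simp
  then have "\<delta> \<le> R" using \<epsilon>(1,2) unfolding \<delta>_def by linarith
  have rL: "0 \<le> r * L" "r * L < 1" "1 - r * L = L / \<kappa>"
  proof -
    show *: "1 - r * L = L / \<kappa>" using L(3) by (simp add: algebra_simps)
    have "0 < L / \<kappa>" using L(1) \<open>0 < \<kappa>\<close> by simp
    with * show "r * L < 1" by linarith
    show "0 \<le> r * L" using r1 L(1) by simp
  qed
  have shift: "dist (v + r *\<^sub>R y) (r *\<^sub>R xb) \<le> \<epsilon> / 3" if "norm v \<le> e" "y \<in> cball xb \<delta>" for v y
  proof -
    have "dist (v + r *\<^sub>R y) (r *\<^sub>R xb) \<le> norm v + r * norm (y - xb)"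
      using norm_add_scaleR_le[of r v "y - xb"] r1
      by (simp add: dist_norm scaleR_diff_right add_diff_eq)
    also have "\<dots> \<le> e + r * \<delta>"
      using that r1 by (intro add_mono mult_left_mono) (auto simp: dist_norm norm_minus_commute)
    finally show ?thesis using e(2) by simp
  qed
  have shiftB: "v + r *\<^sub>R y \<in> B" if "norm v \<le> e" "y \<in> cball xb \<delta>" for v y
    using shift[OF that] \<epsilon>(1) by (simp add: B_def dist_commute)
  have fixpt: "\<exists>!y\<in>cball xb \<delta>. P (v + r *\<^sub>R y) = y" if v: "norm v \<le> e" for v
  proof (rule Banach_fix[OF _ _ rL(1,2)])
    show "complete (cball xb \<delta>)" by (simp add: complete_eq_closed)
    show "cball xb \<delta> \<noteq> {}" using \<delta>(1) by simp
    show "(\<lambda>y. P (v + r *\<^sub>R y)) ` cball xb \<delta> \<subseteq> cball xb \<delta>"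
    proof safe
      fix y assume y: "y \<in> cball xb \<delta>"
      have "dist (P (v + r *\<^sub>R y)) (P (r *\<^sub>R xb)) \<le> L * dist (v + r *\<^sub>R y) (r *\<^sub>R xb)"
        by (rule lipschitz_onD[OF lipP shiftB[OF v y] xbB])
      also have "\<dots> \<le> L * (\<epsilon> / 3)" using shift[OF v y] L(1) by (intro mult_left_mono) auto
      finally show "P (v + r *\<^sub>R y) \<in> cball xb \<delta>" by (simp add: P_xb \<delta>_def dist_commute mult.commute)
    qed
    show "dist (P (v + r *\<^sub>R x)) (P (v + r *\<^sub>R y)) \<le> r * L * dist x y"
      if "x \<in> cball xb \<delta>" "y \<in> cball xb \<delta>" for x y
    proof -
      have "dist (P (v + r *\<^sub>R x)) (P (v + r *\<^sub>R y)) \<le> L * dist (v + r *\<^sub>R x) (v + r *\<^sub>R y)"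
        by (rule lipschitz_onD[OF lipP shiftB[OF v that(1)] shiftB[OF v that(2)]])
      also have "dist (v + r *\<^sub>R x) (v + r *\<^sub>R y) = r * dist x y"
        using r1 by (simp add: dist_norm flip: scaleR_diff_right)
      finally show ?thesis by (simp add: mult.commute mult.left_commute)
    qed
  qed
  then obtain s where s: "\<And>v. norm v \<le> e \<Longrightarrow> s v \<in> cball xb \<delta>" "\<And>v. norm v \<le> e \<Longrightarrow> P (v + r *\<^sub>R s v) = s v"
    by metis
  have s0: "s 0 = xb"
    using fixpt[of 0] s[of 0] P_xb e(1) \<delta>(1) by (metis add_0 centre_in_cball less_imp_le norm_zero)
  have s_growth: "g (s v) + v \<bullet> (y - s v) + (norm (y - s v))\<^sup>2 / (2 * \<kappa>) \<le> g y"
    if v: "norm v \<le> e" and y: "y \<in> \<Gamma> \<inter> cball xb \<delta>" for v y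
  proof -
    define z where "z = v + r *\<^sub>R s v"
    have Pz: "P z = s v" using s(2)[OF v] by (simp add: z_def)
    have zB: "z \<in> B" using shiftB[OF v s(1)[OF v]] by (simp add: z_def)
    have "norm (y - s v) \<le> 2 * \<delta>"
      using y s(1)[OF v] dist_triangle3[of y "s v" xb] by (auto simp: dist_norm)
    then have "norm ((y - s v) /\<^sub>R L) \<le> 2 * (\<delta> / L)"
      unfolding norm_scaleR using L(1) by (simp add: field_simps)
    then have "dist (z + (y - s v) /\<^sub>R L) (r *\<^sub>R xb) \<le> \<epsilon> / 3 + 2 * (\<epsilon> / 3)"
      using norm_triangle_ineq[of "z - r *\<^sub>R xb" "(y - s v) /\<^sub>R L"] shift[OF v s(1)[OF v]]
      unfolding \<delta>(2) z_def[symmetric] by (simp add: dist_norm algebra_simps)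
    then have shifted: "z + (y - P z) /\<^sub>R L \<in> B" by (simp add: Pz B_def dist_commute)
    have yS: "y \<in> S" using y \<open>\<delta> \<le> R\<close> by (auto simp: S_def)
    have zv: "z - r *\<^sub>R s v = v" by (simp add: z_def)
    show ?thesis
      using growth[OF zB yS shifted] unfolding Pz zv .
  qed
  show ?thesis
    unfolding tilt_stable_minimizer_def
  proof (intro conjI exI)
    show "xb \<in> \<Gamma>" "0 < \<kappa>" "0 < \<delta>" by fact+
    show "open (ball 0 e)" "0 \<in> ball 0 e" "s 0 = xb" using e(1) s0 by auto
    show "\<forall>v\<in>ball 0 e. tilt_argmin g \<Gamma> xb \<delta> v = {s v}"
    proof
      fix v :: "real ^ 'n" assume "v \<in> ball 0 e"
      then have v: "norm v \<le> e" by simp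
      have "s v \<in> \<Gamma>" using P(1) s(2)[OF v] by (metis IntD1 S_def)
      have sq: "0 \<le> (norm (y - s v))\<^sup>2 / (2 * \<kappa>)" for y using \<open>0 < \<kappa>\<close> by simp
      show "tilt_argmin g \<Gamma> xb \<delta> v = {s v}"
      proof (intro equalityI subsetI)
        fix y assume "y \<in> tilt_argmin g \<Gamma> xb \<delta> v"
        then have y: "y \<in> \<Gamma> \<inter> cball xb \<delta>" "g y - v \<bullet> y \<le> g (s v) - v \<bullet> s v"
          using \<open>s v \<in> \<Gamma>\<close> s(1)[OF v] by (auto simp: tilt_argmin_def is_arg_min_def not_less)
        have "(norm (y - s v))\<^sup>2 / (2 * \<kappa>) \<le> 0"
          using s_growth[OF v y(1)] y(2) by (simp add: inner_diff_right)
        then show "y \<in> {s v}" using \<open>0 < \<kappa>\<close> by (simp add: divide_le_0_iff)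
      next
        fix y assume "y \<in> {s v}"
        moreover have "g (s v) - v \<bullet> s v \<le> g y - v \<bullet> y" if "y \<in> \<Gamma> \<inter> cball xb \<delta>" for y
          using s_growth[OF v that] sq[of y] by (simp add: inner_diff_right)
        ultimately show "y \<in> tilt_argmin g \<Gamma> xb \<delta> v"
          using \<open>s v \<in> \<Gamma>\<close> s(1)[OF v] by (auto simp: tilt_argmin_def is_arg_min_def not_less)
      qed
    qed
    show "\<kappa>-lipschitz_on (ball 0 e) s"
    proof (rule lipschitz_onI)
      fix v w :: "real ^ 'n" assume "v \<in> ball 0 e" "w \<in> ball 0 e"
      then have vw: "norm v \<le> e" "norm w \<le> e" by auto
      have "dist (s v) (s w) \<le> L * dist (v + r *\<^sub>R s v) (w + r *\<^sub>R s w)"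
        using lipschitz_onD[OF lipP shiftB[OF vw(1) s(1)[OF vw(1)]] shiftB[OF vw(2) s(1)[OF vw(2)]]]
        by (simp add: s(2)[OF vw(1)] s(2)[OF vw(2)])
      also have "\<dots> \<le> L * (dist v w + r * dist (s v) (s w))"
        using norm_add_scaleR_le[of r "v - w" "s v - s w"] r1 L(1)
        by (intro mult_left_mono) (simp_all add: dist_norm scaleR_diff_right algebra_simps)
      finally have "(1 - r * L) * dist (s v) (s w) \<le> L * dist v w" by (simp add: algebra_simps)
      then have "L * dist (s v) (s w) \<le> L * (\<kappa> * dist v w)"
        unfolding rL(3) using \<open>0 < \<kappa>\<close> by (simp add: field_simps)
      then show "dist (s v) (s w) \<le> \<kappa> * dist v w" using L(1) by simp
    qed (use \<open>0 < \<kappa>\<close> in simp)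
  qed
qed

end

theorem theorem4p5:
  fixes g :: "real ^ 'n \<Rightarrow> real" and q :: "real ^ 'n \<Rightarrow> real ^ 'm"
    and xb :: "real ^ 'n" and \<kappa> \<gamma> :: real
  assumes "C2 g" and "\<And>i. C2 (\<lambda>x. q x $ i)"
    and "xb \<in> feasible_set q" and "stationary_point g q xb"
    and "\<kappa> > 0" and "\<gamma> > 0"
    and "MSCQ q xb" and "ereal \<gamma> > subreg q xb"
  shows "(tilt_stable_minimizer g q xb \<kappa> \<longleftrightarrow> RUSOSC g q xb (1 / \<kappa>)) \<and>
    (RUSOSC g q xb (1 / \<kappa>) \<longleftrightarrow>
      (\<exists>\<eta>>0. \<forall>x v lam w.
        (x, v) \<in> gph (Psi g q) \<inter> cball (xb, 0) \<eta> \<longrightarrow>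
        lam \<in> dir_multipliers q x (v - grad g x) w \<inter> cball 0 (\<gamma> * norm (v - grad g x)) \<longrightarrow>
        (\<forall>i\<in>pos_indices lam. grad (\<lambda>y. q y $ i) x \<bullet> w = 0) \<longrightarrow>
        (\<forall>i\<in>active q x - pos_indices lam. 0 \<le> grad (\<lambda>y. q y $ i) x \<bullet> w) \<longrightarrow>
        1 / \<kappa> * (norm w)\<^sup>2 \<le> (hess (\<lambda>y. Lagr g q y lam) x *v w) \<bullet> w))"
    (is "(?i \<longleftrightarrow> ?ii) \<and> (?ii \<longleftrightarrow> ?iii)")
proof -
  obtain c where "mscq_const q xb c" "c < \<gamma>"
    using assms(8) unfolding subreg_def Inf_less_iff by auto
  then obtain U where U: "0 < c" "open U" "xb \<in> U"
    "\<And>x. x \<in> U \<Longrightarrow> infdist x (feasible_set q) \<le> c * infdist (q x) nonpos_orthant"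
    unfolding mscq_const_def by blast
  interpret subregular_program g q U c
    by unfold_locales (use assms(1,2) U in auto)
  obtain l where l: "l \<in> nonneg_orthant" "grad (\<lambda>y. Lagr g q y l) xb = 0" "\<And>i. l $ i * q xb $ i = 0"
    using assms(4) unfolding stationary_point_def by blast
  have "l \<in> multipliers q xb (- grad g xb)"
    using l(1,3) l(2)[unfolded grad_Lagr]
    by (auto simp: multipliers_iff nonneg_orthant_def active_def eq_neg_iff_add_eq_0 add.commute)
  then have "- grad g xb \<in> limiting_normal_cone (feasible_set q) xb"
    by (intro regular_normal_imp_limiting multiplier_imp_regular_normal assms(3))
  then have Psi0: "0 \<in> Psi g q xb" by (simp add: Psi_iff)
  have "?ii" if "?i"
    by (rule tilt_stable_imp_second_order[OF U(3) that])
  moreover have "?iii" if "?ii"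
    using that unfolding RUSOSC_def by blast
  moreover have "?i" if iii: "?iii"
  proof -
    obtain \<eta> where \<eta>: "\<eta> > 0" and so: "\<forall>x v lam w.
        (x, v) \<in> gph (Psi g q) \<inter> cball (xb, 0) \<eta> \<longrightarrow>
        lam \<in> dir_multipliers q x (v - grad g x) w \<inter> cball 0 (\<gamma> * norm (v - grad g x)) \<longrightarrow>
        (\<forall>i\<in>pos_indices lam. grad (\<lambda>y. q y $ i) x \<bullet> w = 0) \<longrightarrow>
        (\<forall>i\<in>active q x - pos_indices lam. 0 \<le> grad (\<lambda>y. q y $ i) x \<bullet> w) \<longrightarrow>
        1 / \<kappa> * (norm w)\<^sup>2 \<le> (hess (\<lambda>y. Lagr g q y lam) x *v w) \<bullet> w"
      using iii by blast
    show ?thesis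
      by (rule second_order_imp_tilt_stable[OF U(3) Psi0 assms(5) less_imp_le[OF \<open>c < \<gamma>\<close>] \<eta>])
         (use so in blast)
  qed
  ultimately show ?thesis by blast
qed

end
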